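(* Let $|\omega|=n$ be even, let $i\in Y_0$ and let $q$ be a positive integer. Define the linear map $$\Theta_i^{(q)}:\mathcal{H}\to\mathcal{W},\qquad \mathrm{D_H}(f)\mapsto x^{\omega}\,(\mathrm{ad}\,\partial_i)^{p^q}(\mathrm{D_H}(f)).$$ Then $\Theta_i^{(q)}\in\mathrm{Der}(\mathcal{H},\mathcal{W})$.
   Context: Let $\mathbb{F}$ be a field of characteristic $p>3$, and let $m>1$, $n>3$ be integers. Put $Y_0=\{1,\dots,2m\}$, $Y_1=\{2m+1,\dots,2m+n\}$, $Y=Y_0\cup Y_1$. Fix $\underline t=(t_1,\dots,t_{2m})$ with positive integer entries, $\pi_i=p^{t_i}-1$, $\pi=(\pi_1,\dots,\pi_{2m})$, $\mathbb{A}=\{\alpha\in\mathbb{N}_0^{2m}:\alpha_i\le\pi_i\}$, $|\alpha|=\sum\alpha_i$; $\varepsilon_i$ is the $i$-th unit vector. $\mathbb{B}_k$ is the set of strictly increasing $k$-tuples $u=\langle i_1,\dots,i_k\rangle$ in $Y_1$ (also viewed as subsets), $|u|=k$, $\mathbb{B}=\bigcup_{k=0}^n\mathbb{B}_k$, $\mathbb{B}^0=\{u\in\mathbb{B}: |u|\text{ even}\}$, $x^u=x_{i_1}\cdots x_{i_k}$, $x^{\emptyset}=1$, $\omega=\langle 2m+1,\dots,2m+n\rangle$ (so $|\omega|=n$). $\mathcal{O}=\mathcal{O}(2m,n;\underline t)$ is the associative superalgebra with basis $\{x^{(\alpha)}x^u:\alpha\in\mathbb{A},u\in\mathbb{B}\}$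 and products $x^{(\alpha)}x^{(\beta)}=\prod_i\binom{\alpha_i+\beta_i}{\alpha_i}x^{(\alpha+\beta)}$ (zero if $\alpha+\beta\notin\mathbb{A}$), $x_kx_l=-x_lx_k$, $x_k^2=0$ for $k,l\in Y_1$, $x^{(\alpha)}x_k=x_kx^{(\alpha)}$; write $x_i=x^{(\varepsilon_i)}$ for $i\in Y_0$. The parity of $x^{(\alpha)}x^u$ is $|u|$ mod 2 and its $\mathbb{Z}$-degree is $|\alpha|+|u|$. The superderivations $\partial_i$ ($i\in Y$) are $\partial_i(x^{(\alpha)}x^u)=x^{(\alpha-\varepsilon_i)}x^u$ for $i\in Y_0$ (zero if $\alpha_i=0$), and $\partial_i(x^{(\alpha)}x^u)=x^{(\alpha)}\,\partial x^u/\partial x_i$ (left derivative) for $i\in Y_1$; $\mu(i)=\overline 0$ for $i\in Y_0$, $\mu(i)=\overline 1$ for $i\in Y_1$ is the parity of $\partial_i$. $W=\{\sum_{i\in Y}a_i\partial_i: a_i\in\mathcal{O}\}$ is the generalized Witt Lie superalgebra (an $\mathcal{O}$-module), with bracket $[a\partial_i,b\partial_j]=a\partial_i(b)\partial_j-(-1)^{\mathrm p(a\partial_i)\mathrm p(b\partial_j)}b\partial_j(a)\partial_i$, where $\mathrm p(a\partial_i)=\mathrm p(a)+\mu(i)$; $(\mathrm{ad}\,D)(x)=[D,x]$. $\mathcal{W}$ is the even part of $W$. For $i\in Y_0$: $i'=i+m$, $\tau(i)=1$ if $i\le m$; $i'=i-m$, $\tau(i)=-1$ if $m<i\le 2m$;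 for $i\in Y_1$: $i'=i$, $\tau(i)=1$. Define the linear map $\mathrm{D_H}:\mathcal{O}\to W$ by $\mathrm{D_H}(a)=\sum_{i\in Y}\tau(i)(-1)^{\mu(i)\mathrm p(a)}\partial_i(a)\partial_{i'}$ for homogeneous $a$. The even part of the Hamiltonian superalgebra is $$\mathcal{H}=\mathrm{span}_{\mathbb{F}}\{\mathrm{D_H}(x^{(\alpha)}x^u):\alpha\in\mathbb{A},u\in\mathbb{B}^0,(\alpha,u)\ne(\pi,\omega)\}\subset\mathcal{W}.$$ A derivation from $\mathcal{H}$ into $\mathcal{W}$ is a linear map $D$ with $D([x,y])=[x,D(y)]-[y,D(x)]$ for all $x,y\in\mathcal{H}$; the space of these is $\mathrm{Der}(\mathcal{H},\mathcal{W})$. *)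

theory Defs
  imports
    Complex_Main
    "HOL-Library.Poly_Mapping"
    "HOL-Library.FuncSet"
    "HOL-Computational_Algebra.Primes"
begin

text \<open>
  The pair \<open>(\<alpha>, u)\<close> indexes the monomial \<open>x\<^sup>(\<^sup>\<alpha>\<^sup>) x\<^sup>u\<close>; the increasing tuple \<open>u\<close> is represented by its
  set of entries. An element of the superalgebra is its finitely supported family of coefficients.

  An element of the generalized Witt superalgebra is the finitely supported family \<open>i \<mapsto> a\<^sub>i\<close> of
  its coefficients in \<open>\<Sum>\<^sub>i a\<^sub>i \<partial>\<^sub>i\<close>. Nothing is lost, since the \<open>\<partial>\<^sub>i\<close> are linearly independent over
  the superalgebra: see \<open>act_gen\<close> and \<open>act_inj\<close> below. So \<open>a \<partial>\<^sub>i\<close> is \<open>Poly_Mapping.single i a\<close>.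
\<close>

type_synonym mono_ix = "(nat \<Rightarrow>\<^sub>0 nat) \<times> nat set"
type_synonym 'k sup = "mono_ix \<Rightarrow>\<^sub>0 'k"
type_synonym 'k wit = "nat \<Rightarrow>\<^sub>0 'k sup"

definition oscale :: "'k::field \<Rightarrow> 'k sup \<Rightarrow> 'k sup" where
  "oscale c f = Poly_Mapping.map ((*) c) f"

definition wscale :: "'k::field \<Rightarrow> 'k wit \<Rightarrow> 'k wit" where
  "wscale c D = Poly_Mapping.map (oscale c) D"

definition xmon :: "(nat \<Rightarrow>\<^sub>0 nat) \<Rightarrow> nat set \<Rightarrow> 'k::field sup" where
  "xmon \<alpha> u = Poly_Mapping.single (\<alpha>, u) 1"

definition has_parity :: "nat \<Rightarrow> 'k::field sup \<Rightarrow> bool" where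
  "has_parity e f \<longleftrightarrow> (\<forall>(\<alpha>, u) \<in> Poly_Mapping.keys f. card u mod 2 = e mod 2)"

text \<open>The homogeneous component of parity \<open>e \<in> {0, 1}\<close>.\<close>

definition hcomp :: "nat \<Rightarrow> 'k::field sup \<Rightarrow> 'k sup" where
  "hcomp e f = (\<Sum>(\<alpha>, u) \<in> {s \<in> Poly_Mapping.keys f. card (snd s) mod 2 = e}.
     Poly_Mapping.single (\<alpha>, u) (Poly_Mapping.lookup f (\<alpha>, u)))"

text \<open>The parameters are constrained only where results are stated.\<close>

locale witt_hamiltonian =
  fixes p m n :: nat and t :: "nat \<Rightarrow> nat"
begin

definition Y0 :: "nat set" where "Y0 = {1..2*m}"
definition Y1 :: "nat set" where "Y1 = {2*m+1..2*m+n}"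
definition Y :: "nat set" where "Y = Y0 \<union> Y1"

definition \<pi> :: "nat \<Rightarrow>\<^sub>0 nat" where
  "\<pi> = (\<Sum>i\<in>Y0. Poly_Mapping.single i (p ^ t i - 1))"

definition \<omega> :: "nat set" where "\<omega> = Y1"

definition \<A> :: "(nat \<Rightarrow>\<^sub>0 nat) set" where
  "\<A> = {\<alpha>. Poly_Mapping.keys \<alpha> \<subseteq> Y0 \<and> (\<forall>i\<in>Y0. Poly_Mapping.lookup \<alpha> i \<le> p ^ t i - 1)}"

definition \<B> :: "nat set set" where "\<B> = Pow Y1"
definition \<B>even :: "nat set set" where "\<B>even = {u \<in> \<B>. even (card u)}"

definition \<O> :: "'k::field sup set" where
  "\<O> = {f. Poly_Mapping.keys f \<subseteq> \<A> \<times> \<B>}"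

text \<open>Sorting \<open>x\<^sup>u x\<^sup>v\<close> transposes each pair \<open>(k, l) \<in> u \<times> v\<close> with \<open>l < k\<close>.\<close>

definition mono_mult :: "mono_ix \<Rightarrow> mono_ix \<Rightarrow> 'k::field sup" where
  "mono_mult s r = (case (s, r) of ((\<alpha>, u), (\<beta>, v)) \<Rightarrow>
     if \<alpha> + \<beta> \<in> \<A> \<and> u \<inter> v = {}
     then Poly_Mapping.single (\<alpha> + \<beta>, u \<union> v)
       ((-1) ^ card {(k, l) \<in> u \<times> v. l < k} *
        of_nat (\<Prod>i\<in>Y0. (Poly_Mapping.lookup \<alpha> i + Poly_Mapping.lookup \<beta> i)
                        choose Poly_Mapping.lookup \<alpha> i))
     else 0)"

definition omult :: "'k::field sup \<Rightarrow> 'k sup \<Rightarrow> 'k sup" where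
  "omult f g = (\<Sum>s\<in>Poly_Mapping.keys f. \<Sum>r\<in>Poly_Mapping.keys g.
     oscale (Poly_Mapping.lookup f s * Poly_Mapping.lookup g r) (mono_mult s r))"

definition gen :: "nat \<Rightarrow> 'k::field sup" where
  "gen i = (if i \<in> Y0 then xmon (Poly_Mapping.single i 1) {} else xmon 0 {i})"

definition mono_deriv :: "nat \<Rightarrow> mono_ix \<Rightarrow> 'k::field sup" where
  "mono_deriv i s = (case s of (\<alpha>, u) \<Rightarrow>
     if i \<in> Y0 then
       (if Poly_Mapping.lookup \<alpha> i = 0 then 0 else xmon (\<alpha> - Poly_Mapping.single i 1) u)
     else
       (if i \<in> u then oscale ((-1) ^ card {j \<in> u. j < i}) (xmon \<alpha> (u - {i})) else 0))"

definition partial :: "nat \<Rightarrow> 'k::field sup \<Rightarrow> 'k sup" where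
  "partial i f = (\<Sum>s\<in>Poly_Mapping.keys f. oscale (Poly_Mapping.lookup f s) (mono_deriv i s))"

definition \<mu> :: "nat \<Rightarrow> nat" where "\<mu> i = (if i \<in> Y1 then 1 else 0)"

definition W :: "'k::field wit set" where
  "W = {D. Poly_Mapping.keys D \<subseteq> Y \<and> (\<forall>i\<in>Y. Poly_Mapping.lookup D i \<in> \<O>)}"

definition omod :: "'k::field sup \<Rightarrow> 'k wit \<Rightarrow> 'k wit" where
  "omod a D = Poly_Mapping.map (omult a) D"

definition act :: "'k::field wit \<Rightarrow> 'k sup \<Rightarrow> 'k sup" where
  "act D f = (\<Sum>i\<in>Y. omult (Poly_Mapping.lookup D i) (partial i f))"

definition pd :: "nat \<Rightarrow> 'k::field wit" where
  "pd i = Poly_Mapping.single i (xmon 0 {})"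

text \<open>
  The bracket on \<open>a \<partial>\<^sub>i\<close> and \<open>b \<partial>\<^sub>j\<close> with \<open>a\<close> and \<open>b\<close> homogeneous of parities \<open>d\<close> and \<open>e\<close>, extended
  biadditively through the decomposition of the coefficients into homogeneous components.
\<close>

definition hbracket :: "nat \<Rightarrow> 'k::field sup \<Rightarrow> nat \<Rightarrow> nat \<Rightarrow> 'k sup \<Rightarrow> nat \<Rightarrow> 'k wit" where
  "hbracket d a i e b j =
     Poly_Mapping.single j (omult a (partial i b)) -
     wscale ((-1) ^ ((d + \<mu> i) * (e + \<mu> j))) (Poly_Mapping.single i (omult b (partial j a)))"

definition bracket :: "'k::field wit \<Rightarrow> 'k wit \<Rightarrow> 'k wit" where
  "bracket D E = (\<Sum>i\<in>Y. \<Sum>j\<in>Y. \<Sum>d\<in>{0, 1}. \<Sum>e\<in>{0, 1}.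
     hbracket d (hcomp d (Poly_Mapping.lookup D i)) i e (hcomp e (Poly_Mapping.lookup E j)) j)"

definition ad :: "'k::field wit \<Rightarrow> 'k wit \<Rightarrow> 'k wit" where
  "ad D E = bracket D E"

definition \<W> :: "'k::field wit set" where
  "\<W> = {D \<in> W. \<forall>i\<in>Y. has_parity (\<mu> i) (Poly_Mapping.lookup D i)}"

definition prime_ix :: "nat \<Rightarrow> nat" where
  "prime_ix i = (if i \<in> Y1 then i else if i \<le> m then i + m else i - m)"

definition \<tau> :: "nat \<Rightarrow> 'k::field" where
  "\<tau> i = (if i \<in> Y1 then 1 else if i \<le> m then 1 else -1)"

definition DH :: "'k::field sup \<Rightarrow> 'k wit" where
  "DH a = (\<Sum>e\<in>{0, 1}. \<Sum>i\<in>Y. wscale (\<tau> i * (-1) ^ (\<mu> i * e))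
     (Poly_Mapping.single (prime_ix i) (partial i (hcomp e a))))"

definition \<H> :: "'k::field wit set" where
  "\<H> = module.span wscale {DH (xmon \<alpha> u) | \<alpha> u. \<alpha> \<in> \<A> \<and> u \<in> \<B>even \<and> (\<alpha>, u) \<noteq> (\<pi>, \<omega>)}"

text \<open>
  A map with domain \<open>L\<close> is represented by a function that is \<open>undefined\<close> outside \<open>L\<close>;
  \<open>L\<close> is meant to be closed under the bracket.
\<close>

definition Der :: "'k::field wit set \<Rightarrow> 'k wit set \<Rightarrow> ('k wit \<Rightarrow> 'k wit) set" where
  "Der L M = {D \<in> L \<rightarrow>\<^sub>E M.
     (\<forall>x\<in>L. \<forall>y\<in>L. D (x + y) = D x + D y) \<and>
     (\<forall>c. \<forall>x\<in>L. D (wscale c x) = wscale c (D x)) \<and>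
     (\<forall>x\<in>L. \<forall>y\<in>L. D (bracket x y) = bracket x (D y) - bracket y (D x))}"

text \<open>The value at \<open>DH f\<close> depends on \<open>DH f\<close> alone, not on the choice of \<open>f\<close>.\<close>

definition \<Theta> :: "nat \<Rightarrow> nat \<Rightarrow> 'k::field wit \<Rightarrow> 'k wit" where
  "\<Theta> i q = (\<lambda>X \<in> \<H>. omod (xmon 0 \<omega>) ((ad (pd i) ^^ (p ^ q)) X))"

end

lemma lookup_oscale [simp]:
  "Poly_Mapping.lookup (oscale c f) s = c * Poly_Mapping.lookup f s"
  by (simp add: oscale_def Poly_Mapping.map.rep_eq when_def)

lemma oscale_zero [simp]: "oscale c 0 = 0"
  by (rule poly_mapping_eqI) simp

lemma oscale_one [simp]: "oscale 1 f = f"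
  by (rule poly_mapping_eqI) simp

lemma lookup_wscale [simp]:
  "Poly_Mapping.lookup (wscale c D) i = oscale c (Poly_Mapping.lookup D i)"
  by (simp add: wscale_def Poly_Mapping.map.rep_eq when_def)

lemma vector_space_wscale: "vector_space (wscale :: 'k::field \<Rightarrow> 'k wit \<Rightarrow> 'k wit)"
  by unfold_locales
    (auto intro!: poly_mapping_eqI simp: lookup_add algebra_simps)

context witt_hamiltonian
begin

lemma partial_xmon: "partial i (xmon \<alpha> u :: 'k::field sup) = mono_deriv i (\<alpha>, u)"
  by (simp add: partial_def xmon_def)

lemma omult_one:
  assumes "f \<in> \<O>"
  shows "omult f (xmon 0 {}) = (f :: 'k::field sup)"
proof -
  have "omult f (xmon 0 {}) =
      (\<Sum>s\<in>Poly_Mapping.keys f. oscale (Poly_Mapping.lookup f s) (mono_mult s (0, {})))"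
    by (simp add: omult_def xmon_def)
  also have "\<dots> = (\<Sum>s\<in>Poly_Mapping.keys f. Poly_Mapping.single s (Poly_Mapping.lookup f s))"
  proof (rule sum.cong)
    fix s assume s: "s \<in> Poly_Mapping.keys f"
    obtain \<alpha> u where "s = (\<alpha>, u)" by fastforce
    with s assms show "oscale (Poly_Mapping.lookup f s) (mono_mult s (0, {})) =
        Poly_Mapping.single s (Poly_Mapping.lookup f s)"
      by (intro poly_mapping_eqI)
        (auto simp: \<O>_def mono_mult_def lookup_single when_def)
  qed simp
  also have "\<dots> = f"
    by (rule poly_mapping_eqI) (simp add: lookup_sum lookup_single when_def in_keys_iff)
  finally show ?thesis .
qed

lemma omult_zero [simp]: "omult f 0 = 0"
  by (simp add: omult_def)

lemma partial_gen:
  assumes "i \<in> Y" "j \<in> Y"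
  shows "partial i (gen j) = (if i = j then xmon 0 {} else (0 :: 'k::field sup))"
proof -
  have [simp]: "{l. l = j \<and> l < j} = {}" by auto
  show ?thesis
    using assms
    by (auto simp: gen_def partial_xmon mono_deriv_def Y_def Y0_def Y1_def lookup_single when_def)
qed

lemma act_gen:
  assumes "D \<in> W" "j \<in> Y"
  shows "act D (gen j) = (Poly_Mapping.lookup D j :: 'k::field sup)"
proof -
  have "act D (gen j) = (\<Sum>i\<in>Y. if i = j then Poly_Mapping.lookup D j else 0)"
    unfolding act_def
    using assms by (intro sum.cong) (auto simp: partial_gen W_def omult_one)
  also have "\<dots> = Poly_Mapping.lookup D j"
    using assms by (simp add: Y_def Y0_def Y1_def)
  finally show ?thesis .
qed

lemma act_inj: "inj_on act (W :: 'k::field wit set)"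
proof (rule inj_onI)
  fix D E :: "'k wit"
  assume DE: "D \<in> W" "E \<in> W" "act D = act E"
  show "D = E"
  proof (rule poly_mapping_eqI)
    fix j
    show "Poly_Mapping.lookup D j = Poly_Mapping.lookup E j"
      using DE act_gen[of D j] act_gen[of E j]
      by (cases "j \<in> Y") (auto simp: W_def in_keys_iff subset_iff, metis)
  qed
qed

end

end

theory Submission
  imports Defs
begin

text \<open>
  On coefficients, the bracket of two even elements is the commutator of vector fields: the \<open>k\<close>-th
  coefficient of \<open>[X, Z]\<close> is \<open>X(Z\<^sub>k) - Z(X\<^sub>k)\<close> (lemma \<open>lookup_bracket\<close>). The map
  \<open>(ad \<partial>\<^sub>i)\<close> to the power \<open>p\<^sup>q\<close> applies \<open>d = \<partial>\<^sub>i\<close> to the power \<open>p\<^sup>q\<close> to every coefficient. In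
  characteristic \<open>p\<close> the iterated Leibniz rule collapses, so \<open>d\<close> is a derivation of \<open>\<O>\<close>
  (\<open>partial_prime_power_leibniz\<close>). As \<open>d\<close> commutes with all \<open>\<partial>\<^sub>k\<close>, applying it to the coefficients
  is a derivation \<open>D\<close> of the bracket (\<open>partial_prime_power_act\<close>).

  Multiply by \<open>w = x\<^sup>\<omega>\<close>, which is even because \<open>n\<close> is. Since an even \<open>X\<close> acts as a derivation of
  \<open>\<O>\<close>, the bracket \<open>[X, w D(Z)]\<close> equals \<open>w [X, D(Z)] + X(w) D(Z)\<close>. Hence
  \<open>\<Theta> = w D\<close> obeys the derivation rule up to the terms \<open>X(w) D(Z)\<close> and \<open>Z(w) D(X)\<close>, and it is
  enough that \<open>X(w) = 0\<close> for every \<open>X\<close> in \<open>\<H>\<close>. Only the odd \<open>\<partial>\<^sub>k\<close> act on \<open>w\<close>. For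
  \<open>X = D\<^sub>H(f)\<close> they contribute \<open>\<partial>\<^sub>k(f) \<partial>\<^sub>k(w)\<close> up to sign, and every monomial of \<open>\<partial>\<^sub>k(f)\<close> contains
  an odd variable other than \<open>x\<^sub>k\<close>, because \<open>f\<close> is even; multiplied by \<open>\<partial>\<^sub>k(w)\<close> it is zero
  (\<open>act_H_top\<close>).

  The derivation rule also requires \<open>[X, Z]\<close> to lie in the domain \<open>\<H>\<close> of \<open>\<Theta>\<close>
  (\<open>H_bracket_closed\<close>). Now \<open>[D\<^sub>H(f), D\<^sub>H(g)]\<close> is \<open>D\<^sub>H\<close> of the Poisson bracket of \<open>f\<close> and
  \<open>g\<close>, and the top monomial excluded from \<open>\<H>\<close> does not occur in a Poisson bracket, since that is a
  sum of derivatives (\<open>lookup_poisson_top\<close>).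
\<close>

section \<open>Extension by linearity\<close>

lemma keys_subset_induct [consumes 1, case_names zero single add]:
  assumes "Poly_Mapping.keys f \<subseteq> S"
    and zero: "P 0"
    and single: "\<And>s c. s \<in> S \<Longrightarrow> P (Poly_Mapping.single s c)"
    and add: "\<And>f g. Poly_Mapping.keys f \<subseteq> S \<Longrightarrow> Poly_Mapping.keys g \<subseteq> S \<Longrightarrow> P f \<Longrightarrow> P g \<Longrightarrow> P (f + g)"
  shows "P (f :: 'a \<Rightarrow>\<^sub>0 'b::comm_monoid_add)"
proof -
  have *: "Poly_Mapping.keys (\<Sum>s\<in>T. Poly_Mapping.single s (c s)) \<subseteq> S \<and>
      P (\<Sum>s\<in>T. Poly_Mapping.single s (c s))" if "finite T" "T \<subseteq> S" for T c
    using that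
  proof (induction T rule: finite_induct)
    case (insert x T)
    have "Poly_Mapping.keys (Poly_Mapping.single x (c x)) \<subseteq> S"
      using insert.prems by (auto split: if_splits)
    with insert keys_add[of "Poly_Mapping.single x (c x)" "\<Sum>s\<in>T. Poly_Mapping.single s (c s)"]
    show ?case
      by (simp add: single add subset_trans[OF keys_add])
  qed (simp add: zero)
  have "f = (\<Sum>s\<in>Poly_Mapping.keys f. Poly_Mapping.single s (Poly_Mapping.lookup f s))"
    by (rule poly_mapping_eqI) (simp add: lookup_sum lookup_single when_def in_keys_iff)
  with *[of "Poly_Mapping.keys f" "Poly_Mapping.lookup f"] assms(1) show ?thesis
    by simp
qed

lemma additive_eq_on_keys:
  fixes F G :: "('a \<Rightarrow>\<^sub>0 'b::comm_monoid_add) \<Rightarrow> 'c::ab_group_add"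
  assumes F: "\<And>f g. F (f + g) = F f + F g" and G: "\<And>f g. G (f + g) = G f + G g"
    and eq: "\<And>s c. s \<in> S \<Longrightarrow> F (Poly_Mapping.single s c) = G (Poly_Mapping.single s c)"
    and "Poly_Mapping.keys f \<subseteq> S"
  shows "F f = G f"
  using assms(4)
proof (induction rule: keys_subset_induct)
  case zero
  show ?case using F[of 0 0] G[of 0 0] by simp
qed (simp_all add: F G eq)

lemma biadditive_eq_on_keys:
  fixes F G :: "('a \<Rightarrow>\<^sub>0 'b::comm_monoid_add) \<Rightarrow> ('a \<Rightarrow>\<^sub>0 'b) \<Rightarrow> 'c::ab_group_add"
  assumes F: "\<And>f g h. F (f + g) h = F f h + F g h" "\<And>f g h. F h (f + g) = F h f + F h g"
    and G: "\<And>f g h. G (f + g) h = G f h + G g h" "\<And>f g h. G h (f + g) = G h f + G h g"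
    and eq: "\<And>s c r d. s \<in> S \<Longrightarrow> r \<in> R \<Longrightarrow>
      F (Poly_Mapping.single s c) (Poly_Mapping.single r d) =
      G (Poly_Mapping.single s c) (Poly_Mapping.single r d)"
    and "Poly_Mapping.keys f \<subseteq> S" "Poly_Mapping.keys g \<subseteq> R"
  shows "F f g = G f g"
proof (rule additive_eq_on_keys[OF _ _ _ assms(6)])
  fix s c assume "s \<in> S"
  then show "F (Poly_Mapping.single s c) g = G (Poly_Mapping.single s c) g"
    by (intro additive_eq_on_keys[OF F(2) G(2) _ assms(7)] eq)
qed (rule F G)+

lemma oscale_add_right: "oscale c (f + g) = oscale c f + oscale c g"
  by (rule poly_mapping_eqI) (simp add: lookup_add algebra_simps)

lemma oscale_diff_right: "oscale c (f - g) = oscale c f - oscale c g"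
  by (rule poly_mapping_eqI) (simp add: lookup_minus algebra_simps)

lemma oscale_add_left: "oscale (c + d) f = oscale c f + oscale d f"
  by (rule poly_mapping_eqI) (simp add: lookup_add algebra_simps)

lemma oscale_uminus_left [simp]: "oscale (- c) f = - oscale c f"
  by (rule poly_mapping_eqI) simp

lemma oscale_oscale [simp]: "oscale c (oscale d f) = oscale (c * d) f"
  by (rule poly_mapping_eqI) (simp add: mult.assoc)

lemma oscale_zero_left [simp]: "oscale 0 f = 0"
  by (rule poly_mapping_eqI) simp

lemma oscale_sum: "oscale c (\<Sum>x\<in>X. f x) = (\<Sum>x\<in>X. oscale c (f x))"
  by (induction X rule: infinite_finite_induct) (simp_all add: oscale_add_right)

lemma oscale_single [simp]: "oscale c (Poly_Mapping.single s d) = Poly_Mapping.single s (c * d)"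
  by (rule poly_mapping_eqI) (simp add: lookup_single when_def)

lemma keys_oscale: "Poly_Mapping.keys (oscale c f) \<subseteq> Poly_Mapping.keys f"
  by (auto simp: in_keys_iff)

context witt_hamiltonian
begin

notation omult (infixl "\<star>" 70)

lemma omult_supersets:
  assumes "finite S" "Poly_Mapping.keys f \<subseteq> S" "finite R" "Poly_Mapping.keys g \<subseteq> R"
  shows "f \<star> g = (\<Sum>s\<in>S. \<Sum>r\<in>R.
    oscale (Poly_Mapping.lookup f s * Poly_Mapping.lookup g r) (mono_mult s r))"
proof -
  have "(\<Sum>r\<in>Poly_Mapping.keys g.
        oscale (Poly_Mapping.lookup f s * Poly_Mapping.lookup g r) (mono_mult s r)) =
      (\<Sum>r\<in>R. oscale (Poly_Mapping.lookup f s * Poly_Mapping.lookup g r) (mono_mult s r))" for s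
    using assms by (intro sum.mono_neutral_left) (auto simp: in_keys_iff)
  then have "f \<star> g = (\<Sum>s\<in>Poly_Mapping.keys f. \<Sum>r\<in>R.
      oscale (Poly_Mapping.lookup f s * Poly_Mapping.lookup g r) (mono_mult s r))"
    by (simp add: omult_def)
  also have "\<dots> = (\<Sum>s\<in>S. \<Sum>r\<in>R.
      oscale (Poly_Mapping.lookup f s * Poly_Mapping.lookup g r) (mono_mult s r))"
    using assms by (intro sum.mono_neutral_left) (auto simp: in_keys_iff)
  finally show ?thesis .
qed

lemma omult_add_left: "(f + g) \<star> h = f \<star> h + g \<star> h"
proof -
  let ?S = "Poly_Mapping.keys f \<union> Poly_Mapping.keys g"
  have "Poly_Mapping.keys (f + g) \<subseteq> ?S" by (rule keys_add)
  then show ?thesis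
    using omult_supersets[of ?S "f + g" "Poly_Mapping.keys h" h]
      omult_supersets[of ?S f "Poly_Mapping.keys h" h] omult_supersets[of ?S g "Poly_Mapping.keys h" h]
    by (simp add: lookup_add distrib_right oscale_add_left sum.distrib)
qed

lemma omult_add_right: "h \<star> (f + g) = h \<star> f + h \<star> g"
proof -
  let ?S = "Poly_Mapping.keys f \<union> Poly_Mapping.keys g"
  have "Poly_Mapping.keys (f + g) \<subseteq> ?S" by (rule keys_add)
  then show ?thesis
    using omult_supersets[of "Poly_Mapping.keys h" h ?S "f + g"]
      omult_supersets[of "Poly_Mapping.keys h" h ?S f] omult_supersets[of "Poly_Mapping.keys h" h ?S g]
    by (simp add: lookup_add distrib_left oscale_add_left sum.distrib)
qed

lemma omult_zero_left [simp]: "0 \<star> f = 0"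
  by (simp add: omult_def)

lemma omult_oscale_left: "oscale c f \<star> g = oscale c (f \<star> g)"
  using omult_supersets[of "Poly_Mapping.keys f" "oscale c f" "Poly_Mapping.keys g" g]
  by (simp add: keys_oscale omult_def oscale_sum mult.assoc)

lemma omult_oscale_right: "f \<star> oscale c g = oscale c (f \<star> g)"
  using omult_supersets[of "Poly_Mapping.keys f" f "Poly_Mapping.keys g" "oscale c g"]
  by (simp add: keys_oscale omult_def oscale_sum mult_ac)

lemma omult_uminus_right [simp]: "f \<star> (- g) = - (f \<star> g)"
  using omult_oscale_right[of f "-1" g] by simp

lemma omult_diff_right: "h \<star> (f - g) = h \<star> f - h \<star> g"
  using omult_add_right[of h f "- g"] by simp

lemma omult_sum_left: "(\<Sum>x\<in>X. f x) \<star> g = (\<Sum>x\<in>X. f x \<star> g)"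
  by (induction X rule: infinite_finite_induct) (simp_all add: omult_add_left)

lemma omult_sum_right: "g \<star> (\<Sum>x\<in>X. f x) = (\<Sum>x\<in>X. g \<star> f x)"
  by (induction X rule: infinite_finite_induct) (simp_all add: omult_add_right)

lemma partial_superset:
  assumes "finite S" "Poly_Mapping.keys f \<subseteq> S"
  shows "partial i f = (\<Sum>s\<in>S. oscale (Poly_Mapping.lookup f s) (mono_deriv i s))"
  unfolding partial_def using assms by (intro sum.mono_neutral_left) (auto simp: in_keys_iff)

lemma partial_add: "partial i (f + g) = partial i f + partial i g"
proof -
  let ?S = "Poly_Mapping.keys f \<union> Poly_Mapping.keys g"
  have "Poly_Mapping.keys (f + g) \<subseteq> ?S" by (rule keys_add)
  then show ?thesis
    using partial_superset[of ?S "f + g" i] partial_superset[of ?S f i] partial_superset[of ?S g i]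
    by (simp add: lookup_add oscale_add_left sum.distrib)
qed

lemma partial_zero [simp]: "partial i 0 = 0"
  by (simp add: partial_def)

lemma partial_oscale: "partial i (oscale c f) = oscale c (partial i f)"
  using partial_superset[of "Poly_Mapping.keys f" "oscale c f" i]
  by (simp add: keys_oscale partial_def oscale_sum)

lemma partial_uminus [simp]: "partial i (- f) = - partial i f"
  using partial_oscale[of i "-1" f] by simp

lemma partial_diff: "partial i (f - g) = partial i f - partial i g"
  using partial_add[of i f "- g"] by simp

lemma partial_sum: "partial i (\<Sum>x\<in>X. f x) = (\<Sum>x\<in>X. partial i (f x))"
  by (induction X rule: infinite_finite_induct) (simp_all add: partial_add)

lemma partial_single:
  "partial i (Poly_Mapping.single s c) = oscale c (mono_deriv i s)"
  by (simp add: partial_def)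

lemma omult_single:
  "Poly_Mapping.single s c \<star> Poly_Mapping.single r d = oscale (c * d) (mono_mult s r)"
  by (simp add: omult_def)

end

section \<open>Signs and divided-power coefficients\<close>

text \<open>
  The vanishing on the diagonal makes \<open>shuffle_sign u v\<close>, a product over all pairs, the full
  coefficient of \<open>x\<^sup>u\<^sup>\<union>\<^sup>v\<close> in \<open>x\<^sup>u x\<^sup>v\<close>: it is zero when \<open>u\<close> and \<open>v\<close> meet. So no
  disjointness has to be carried along, and the sign rules reduce to products over unions.
\<close>

definition order_sign :: "nat \<Rightarrow> nat \<Rightarrow> 'k::field" where
  "order_sign k l = (if l < k then -1 else if k < l then 1 else 0)"

definition shuffle_sign :: "nat set \<Rightarrow> nat set \<Rightarrow> 'k::field" where
  "shuffle_sign u v = (\<Prod>k\<in>u. \<Prod>l\<in>v. order_sign k l)"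

lemma shuffle_sign_Un_left:
  "finite u \<Longrightarrow> finite u' \<Longrightarrow> u \<inter> u' = {} \<Longrightarrow>
    shuffle_sign (u \<union> u') v = shuffle_sign u v * shuffle_sign u' v"
  by (simp add: shuffle_sign_def prod.union_disjoint)

lemma shuffle_sign_Un_right:
  "finite v \<Longrightarrow> finite v' \<Longrightarrow> v \<inter> v' = {} \<Longrightarrow>
    shuffle_sign u (v \<union> v') = shuffle_sign u v * shuffle_sign u v'"
  by (simp add: shuffle_sign_def prod.union_disjoint prod.distrib)

lemma shuffle_sign_singletons [simp]: "shuffle_sign {k} {l} = order_sign k l"
  by (simp add: shuffle_sign_def)

lemma shuffle_sign_remove_left:
  "finite u \<Longrightarrow> i \<in> u \<Longrightarrow> shuffle_sign u v = shuffle_sign {i} v * shuffle_sign (u - {i}) v"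
  by (simp add: shuffle_sign_def prod.remove)

lemma shuffle_sign_remove_right:
  "finite v \<Longrightarrow> i \<in> v \<Longrightarrow> shuffle_sign u v = shuffle_sign u {i} * shuffle_sign u (v - {i})"
  by (simp add: shuffle_sign_def prod.remove prod.distrib)

lemma shuffle_sign_eq_0:
  assumes "finite u" "finite v" "u \<inter> v \<noteq> {}"
  shows "shuffle_sign u v = 0"
proof -
  from assms obtain i where "i \<in> u" "i \<in> v" by auto
  with assms show ?thesis
    by (simp add: shuffle_sign_remove_left[of u i] shuffle_sign_remove_right[of v i] order_sign_def)
qed

lemma shuffle_sign_card:
  assumes "finite u" "finite v"
  shows "shuffle_sign u v = (if u \<inter> v = {} then (-1) ^ card {(k, l) \<in> u \<times> v. l < k} else 0)"
proof (cases "u \<inter> v = {}")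
  case True
  have "shuffle_sign u v = (\<Prod>s\<in>u \<times> v. order_sign (fst s) (snd s) :: 'a)"
    by (simp add: shuffle_sign_def prod.cartesian_product case_prod_beta)
  also have "\<dots> = (\<Prod>s\<in>u \<times> v. if snd s < fst s then -1 else 1)"
    using True by (intro prod.cong) (auto simp: order_sign_def)
  also have "\<dots> = (-1) ^ card {s \<in> u \<times> v. snd s < fst s}"
    using assms by (simp flip: prod.inter_filter)
  also have "{s \<in> u \<times> v. snd s < fst s} = {(k, l) \<in> u \<times> v. l < k}" by auto
  finally show ?thesis using True by simp
qed (use assms shuffle_sign_eq_0 in auto)

lemma shuffle_sign_swap:
  assumes "finite u" "finite v"
  shows "shuffle_sign u v = (-1) ^ (card u * card v) * shuffle_sign v u"
proof -
  have "shuffle_sign u v = (\<Prod>k\<in>u. \<Prod>l\<in>v. - order_sign l k :: 'a)"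
    unfolding shuffle_sign_def by (intro prod.cong) (auto simp: order_sign_def)
  also have "\<dots> = (\<Prod>k\<in>u. (-1) ^ card v * (\<Prod>l\<in>v. order_sign l k))"
    by (simp add: prod_uminus)
  also have "\<dots> = (-1) ^ (card u * card v) * (\<Prod>k\<in>u. \<Prod>l\<in>v. order_sign l k)"
    by (simp add: prod.distrib mult.commute flip: power_mult)
  also have "(\<Prod>k\<in>u. \<Prod>l\<in>v. order_sign l k) = (shuffle_sign v u :: 'a)"
    unfolding shuffle_sign_def by (rule prod.swap)
  finally show ?thesis .
qed

lemma shuffle_sign_square:
  assumes "finite u" "finite v" "u \<inter> v = {}"
  shows "shuffle_sign u v * shuffle_sign u v = 1"
  using assms by (simp add: shuffle_sign_card flip: power_add mult_2)

text \<open>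
  Left differentiation moves \<open>x\<^sub>i\<close> to the front of \<open>x\<^sup>u\<close> and removes it; its sign is therefore the
  one in \<open>x\<^sup>u = \<plusminus> x\<^sub>i x\<^sup>u\<^sup>-\<^sup>i\<close>.
\<close>

definition front_sign :: "nat \<Rightarrow> nat set \<Rightarrow> 'k::field" where
  "front_sign i u = (if i \<in> u then shuffle_sign {i} (u - {i}) else 0)"

lemma front_sign_card:
  assumes "finite u" "i \<in> u"
  shows "front_sign i u = (-1) ^ card {j \<in> u. j < i}"
proof -
  have "{(k, l) \<in> {i} \<times> (u - {i}). l < k} = Pair i ` {j \<in> u. j < i}" by auto
  then have "card {(k, l) \<in> {i} \<times> (u - {i}). l < k} = card {j \<in> u. j < i}"
    by (simp add: card_image inj_on_def)
  with assms show ?thesis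
    by (simp add: front_sign_def shuffle_sign_card)
qed

lemma mult_self_cancel:
  "x * x = (1 :: 'k::field) \<Longrightarrow> x * (x * y) = y"
  by (simp flip: mult.assoc)

lemma front_sign_Un_left:
  assumes "finite u" "finite v" "i \<in> u" "i \<notin> v"
  shows "shuffle_sign u v * front_sign i (u \<union> v) =
    (front_sign i u * shuffle_sign (u - {i}) v :: 'k::field)"
proof (cases "u \<inter> v = {}")
  case True
  have "u \<union> v - {i} = (u - {i}) \<union> v" using assms by auto
  with assms True
  have union: "front_sign i (u \<union> v) = (front_sign i u * shuffle_sign {i} v :: 'k)"
    by (simp add: front_sign_def) (subst shuffle_sign_Un_right; auto)
  have "shuffle_sign {i} v * shuffle_sign {i} v = (1 :: 'k)"
    using assms by (intro shuffle_sign_square) auto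
  then show ?thesis
    unfolding union shuffle_sign_remove_left[OF assms(1,3), of v] by algebra
next
  case False
  then have "(u - {i}) \<inter> v \<noteq> {}" using assms by auto
  with False assms show ?thesis by (simp add: shuffle_sign_eq_0)
qed

lemma front_sign_Un_right:
  assumes "finite u" "finite v" "i \<notin> u" "i \<in> v"
  shows "shuffle_sign u v * front_sign i (u \<union> v) =
    ((-1) ^ card u * (front_sign i v * shuffle_sign u (v - {i})) :: 'k::field)"
proof (cases "u \<inter> v = {}")
  case True
  have "u \<union> v - {i} = u \<union> (v - {i})" using assms by auto
  with assms True
  have union: "front_sign i (u \<union> v) = (shuffle_sign {i} u * front_sign i v :: 'k)"
    by (simp add: front_sign_def) (subst shuffle_sign_Un_right; auto)
  have swap: "shuffle_sign u {i} = ((-1) ^ card u * shuffle_sign {i} u :: 'k)"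
    using assms shuffle_sign_swap[of u "{i}"] by simp
  have "shuffle_sign {i} u * shuffle_sign {i} u = (1 :: 'k)"
    using assms by (intro shuffle_sign_square) auto
  then show ?thesis
    unfolding union shuffle_sign_remove_right[OF assms(2,4), of u] swap
    by (simp add: mult_ac mult_self_cancel)
next
  case False
  then have "u \<inter> (v - {i}) \<noteq> {}" using assms by auto
  with False assms show ?thesis by (simp add: shuffle_sign_eq_0)
qed

text \<open>
  Since \<open>x\<^sub>i\<^sup>2 = 0\<close>, two monomials that share \<open>x\<^sub>i\<close> have product zero. The two terms of the Leibniz
  rule must then cancel.
\<close>

lemma front_sign_both:
  assumes "finite u" "finite v" "i \<in> u" "i \<in> v"
  shows "front_sign i u * shuffle_sign (u - {i}) v =
    - ((-1) ^ card u * (front_sign i v * shuffle_sign u (v - {i})) :: 'k::field)"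
proof -
  have card: "card u = Suc (card (u - {i}))"
    using assms by (metis card.remove)
  have swap: "shuffle_sign (u - {i}) {i} =
      ((-1) ^ card (u - {i}) * shuffle_sign {i} (u - {i}) :: 'k)"
    using assms shuffle_sign_swap[of "u - {i}" "{i}"] by simp
  have front: "front_sign i u = (shuffle_sign {i} (u - {i}) :: 'k)"
    "front_sign i v = (shuffle_sign {i} (v - {i}) :: 'k)"
    using assms by (simp_all add: front_sign_def)
  have "shuffle_sign {i} (u - {i}) * shuffle_sign {i} (u - {i}) = (1 :: 'k)"
    "shuffle_sign {i} (v - {i}) * shuffle_sign {i} (v - {i}) = (1 :: 'k)"
    using assms by (auto intro!: shuffle_sign_square)
  then show ?thesis
    unfolding front card power_Suc shuffle_sign_remove_right[OF assms(2,4), of "u - {i}"]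
      shuffle_sign_remove_left[OF assms(1,3), of "v - {i}"] swap
    by (simp add: mult_ac mult_self_cancel)
qed

lemma front_sign_remove:
  assumes "finite u" "i \<in> u" "j \<in> u" "i \<noteq> j"
  shows "front_sign j u * front_sign i (u - {j}) = - (front_sign i u * front_sign j (u - {i}))"
proof -
  have "u - {j} - {i} = u - {i} - {j}" by auto
  moreover have "order_sign i j = - (order_sign j i :: 'a)"
    by (simp add: order_sign_def)
  ultimately show ?thesis
    using assms
    by (simp add: front_sign_def shuffle_sign_remove_right[of "u - {j}" i] shuffle_sign_remove_right[of "u - {i}" j])
qed

text \<open>
  Cutting off at \<open>r\<close> is what the restriction of the exponents to \<open>\<A>\<close> amounts to, one variable
  at a time.
\<close>

definition dp_coeff :: "nat \<Rightarrow> nat \<Rightarrow> nat \<Rightarrow> 'k::field" where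
  "dp_coeff r a b = (if a + b \<le> r then of_nat ((a + b) choose a) else 0)"

lemma dp_coeff_commute: "dp_coeff r a b = dp_coeff r b a"
  using binomial_symmetric[of a "a + b"] by (simp add: dp_coeff_def add.commute)

lemma dp_coeff_assoc:
  "dp_coeff r a b * dp_coeff r (a + b) c = dp_coeff r b c * dp_coeff r a (b + c)"
proof -
  have ab: "fact a * fact b * ((a + b) choose a) = fact (a + b)"
    and bc: "fact b * fact c * ((b + c) choose b) = fact (b + c)"
    using binomial_fact_lemma[of a "a + b"] binomial_fact_lemma[of b "b + c"] by simp_all
  have "fact a * fact b * fact c * (((a + b) choose a) * ((a + b + c) choose (a + b))) =
      (fact a * fact b * ((a + b) choose a)) * fact c * ((a + b + c) choose (a + b))"
    by (simp only: mult_ac)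
  also have "\<dots> = fact (a + b + c)"
    unfolding ab using binomial_fact_lemma[of "a + b" "a + b + c"] by simp
  also have "\<dots> = fact a * (fact b * fact c * ((b + c) choose b)) * ((a + b + c) choose a)"
    unfolding bc using binomial_fact_lemma[of a "a + b + c"] by (simp add: add.assoc)
  also have "\<dots> = fact a * fact b * fact c * (((b + c) choose b) * ((a + b + c) choose a))"
    by (simp only: mult_ac)
  finally have "fact a * fact b * fact c * (((a + b) choose a) * ((a + b + c) choose (a + b))) =
      fact a * fact b * fact c * (((b + c) choose b) * ((a + b + c) choose a))" .
  then have "((a + b) choose a) * ((a + b + c) choose (a + b)) = 
      ((b + c) choose b) * ((a + b + c) choose a)"
    by simp
  then show ?thesis
    by (auto simp: dp_coeff_def add_ac simp flip: of_nat_mult)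
qed

lemma prime_dvd_prime_power_choose:
  assumes "prime (p::nat)" "0 < k" "k < p ^ N"
  shows "p dvd (p ^ N choose k)"
proof (rule ccontr)
  assume "\<not> p dvd (p ^ N choose k)"
  then have "coprime (p ^ N) (p ^ N choose k)"
    using assms(1) by (simp add: prime_imp_coprime)
  moreover have "p ^ N dvd k * (p ^ N choose k)"
    using assms binomial_absorption[of "k - 1" "p ^ N"] by simp
  ultimately have "p ^ N dvd k"
    by (simp add: coprime_dvd_mult_left_iff)
  with assms show False by (simp add: nat_dvd_not_less)
qed

text \<open>
  Pascal's rule survives the truncation: the only case in which the cut-off removes the left-hand
  side but not the right-hand side is \<open>a + b = p\<^sup>N\<close>, and there \<open>p\<close> divides the binomial
  coefficient.
\<close>

lemma dp_coeff_pascal: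
  assumes "CHAR('k) = p" "prime p" "a \<le> p ^ N - 1" "b \<le> p ^ N - 1"
  shows "(if a + b = 0 then 0 else dp_coeff (p ^ N - 1) a b) =
    (if a = 0 then 0 else dp_coeff (p ^ N - 1) (a - 1) b) +
    (if b = 0 then 0 else dp_coeff (p ^ N - 1) a (b - 1) :: 'k::field)"
proof (cases "a = 0 \<or> b = 0")
  case False
  then obtain a' b' where ab: "a = Suc a'" "b = Suc b'"
    by (metis not0_implies_Suc)
  have pos: "p ^ N > 0" using assms(2) by (simp add: prime_gt_0_nat)
  have pascal: "((a + b) choose a) = ((a' + b) choose a') + ((a + b') choose a)"
    using ab by simp
  consider "a + b < p ^ N" | "a + b = p ^ N" | "a + b > p ^ N" by linarith
  then show ?thesis
  proof cases
    case 1
    with ab pascal show ?thesis by (simp add: dp_coeff_def)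
  next
    case 2
    have "p dvd ((a + b) choose a)"
      unfolding 2 using assms pos ab by (intro prime_dvd_prime_power_choose) auto
    then have "of_nat ((a + b) choose a) = (0 :: 'k)"
      using assms(1) by (simp add: of_nat_eq_0_iff_char_dvd)
    then have "of_nat ((a' + b) choose a') + of_nat ((a + b') choose a) = (0 :: 'k)"
      unfolding pascal by simp
    with ab pos 2 show ?thesis
      by (simp add: dp_coeff_def del: binomial_Suc_Suc) linarith
  next
    case 3
    with ab show ?thesis by (simp add: dp_coeff_def)
  qed
qed (use assms in \<open>auto simp: dp_coeff_def\<close>)

section \<open>The superalgebra \<open>\<O>\<close> and its superderivations\<close>

context witt_hamiltonian
begin

definition homogeneous :: "nat \<Rightarrow> 'k::field sup set" where
  "homogeneous e = {f \<in> \<O>. has_parity e f}"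

lemma homogeneous_subset_O: "homogeneous e \<subseteq> \<O>"
  by (auto simp: homogeneous_def)

lemma homogeneous_keys:
  "f \<in> homogeneous e \<longleftrightarrow>
    Poly_Mapping.keys f \<subseteq> {(\<alpha>, u). \<alpha> \<in> \<A> \<and> u \<in> \<B> \<and> card u mod 2 = e mod 2}"
  by (auto simp: homogeneous_def \<O>_def has_parity_def)

lemma homogeneous_cong: "d mod 2 = e mod 2 \<Longrightarrow> homogeneous d = homogeneous e"
  by (auto simp: homogeneous_def has_parity_def)

lemma finite_Y [simp]: "finite Y0" "finite Y1" "finite Y"
  by (auto simp: Y0_def Y1_def Y_def)

lemma Y0_Y1_disjoint: "i \<in> Y0 \<Longrightarrow> i \<notin> Y1"
  by (auto simp: Y0_def Y1_def)

lemma mu_simps [simp]: "i \<in> Y0 \<Longrightarrow> \<mu> i = 0" "i \<in> Y1 \<Longrightarrow> \<mu> i = 1"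
  by (auto simp: \<mu>_def Y0_Y1_disjoint)

lemma finite_B: "u \<in> \<B> \<Longrightarrow> finite u"
  by (auto simp: \<B>_def intro: finite_subset)

lemma zero_in_homogeneous [simp]: "0 \<in> homogeneous e"
  and add_in_homogeneous: "f \<in> homogeneous e \<Longrightarrow> g \<in> homogeneous e \<Longrightarrow> f + g \<in> homogeneous e"
  and oscale_in_homogeneous: "f \<in> homogeneous e \<Longrightarrow> oscale c f \<in> homogeneous e"
  using keys_add[of f g] keys_oscale[of c f] by (auto simp: homogeneous_keys)

lemma zero_in_O [simp]: "0 \<in> \<O>"
  and add_in_O: "f \<in> \<O> \<Longrightarrow> g \<in> \<O> \<Longrightarrow> f + g \<in> \<O>"
  using keys_add[of f g] by (auto simp: \<O>_def)

lemma sum_in_homogeneous: "(\<And>x. x \<in> X \<Longrightarrow> f x \<in> homogeneous e) \<Longrightarrow> sum f X \<in> homogeneous e"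
  by (induction X rule: infinite_finite_induct) (auto intro: add_in_homogeneous)

definition multi_coeff :: "(nat \<Rightarrow>\<^sub>0 nat) \<Rightarrow> (nat \<Rightarrow>\<^sub>0 nat) \<Rightarrow> 'k::field" where
  "multi_coeff \<alpha> \<beta> =
    (\<Prod>j\<in>Y0. dp_coeff (p ^ t j - 1) (Poly_Mapping.lookup \<alpha> j) (Poly_Mapping.lookup \<beta> j))"

lemma mono_mult_eq:
  assumes "Poly_Mapping.keys \<alpha> \<subseteq> Y0" "Poly_Mapping.keys \<beta> \<subseteq> Y0" "u \<in> \<B>" "v \<in> \<B>"
  shows "mono_mult (\<alpha>, u) (\<beta>, v) =
    Poly_Mapping.single (\<alpha> + \<beta>, u \<union> v) (shuffle_sign u v * multi_coeff \<alpha> \<beta>)"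
proof -
  have "Poly_Mapping.keys (\<alpha> + \<beta>) \<subseteq> Y0"
    using keys_add[of \<alpha> \<beta>] assms by auto
  then have A: "\<alpha> + \<beta> \<in> \<A> \<longleftrightarrow>
      (\<forall>j\<in>Y0. Poly_Mapping.lookup \<alpha> j + Poly_Mapping.lookup \<beta> j \<le> p ^ t j - 1)"
    by (simp add: \<A>_def lookup_add)
  have "multi_coeff \<alpha> \<beta> = (if \<alpha> + \<beta> \<in> \<A> then of_nat (\<Prod>i\<in>Y0.
      (Poly_Mapping.lookup \<alpha> i + Poly_Mapping.lookup \<beta> i) choose Poly_Mapping.lookup \<alpha> i) else 0 :: 'a)"
  proof (cases "\<alpha> + \<beta> \<in> \<A>")
    case False
    with A show ?thesis
      by (auto simp: multi_coeff_def dp_coeff_def intro!: prod_zero)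
  qed (use A in \<open>simp add: multi_coeff_def dp_coeff_def\<close>)
  with assms show ?thesis
    by (auto simp: mono_mult_def shuffle_sign_card finite_B)
qed

lemma keys_subset_Y0_of_A: "\<alpha> \<in> \<A> \<Longrightarrow> Poly_Mapping.keys \<alpha> \<subseteq> Y0"
  by (simp add: \<A>_def)

lemma omult_monomials:
  assumes "Poly_Mapping.keys \<alpha> \<subseteq> Y0" "Poly_Mapping.keys \<beta> \<subseteq> Y0" "u \<in> \<B>" "v \<in> \<B>"
  shows "Poly_Mapping.single (\<alpha>, u) c \<star> Poly_Mapping.single (\<beta>, v) d =
    Poly_Mapping.single (\<alpha> + \<beta>, u \<union> v) (c * d * (shuffle_sign u v * multi_coeff \<alpha> \<beta>))"
  using assms by (simp add: omult_single mono_mult_eq)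

lemma partial_monomial_even:
  assumes "i \<in> Y0"
  shows "partial i (Poly_Mapping.single (\<alpha>, u) c) = Poly_Mapping.single (\<alpha> - Poly_Mapping.single i 1, u)
    (if Poly_Mapping.lookup \<alpha> i = 0 then 0 else c)"
  using assms by (simp add: partial_single mono_deriv_def xmon_def)

lemma partial_monomial_odd:
  assumes "i \<in> Y1" "u \<in> \<B>"
  shows "partial i (Poly_Mapping.single (\<alpha>, u) c) =
    Poly_Mapping.single (\<alpha>, u - {i}) (c * front_sign i u)"
proof (cases "i \<in> u")
  case True
  with assms Y0_Y1_disjoint[of i] finite_B[of u] show ?thesis
    by (auto simp: partial_single mono_deriv_def xmon_def front_sign_card)
next
  case False
  with assms Y0_Y1_disjoint[of i] show ?thesis
    by (auto simp: partial_single mono_deriv_def front_sign_def)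
qed

lemma A_minus_unit: "\<alpha> \<in> \<A> \<Longrightarrow> \<alpha> - Poly_Mapping.single i 1 \<in> \<A>"
  by (auto simp: \<A>_def lookup_minus in_keys_iff subset_iff intro: le_trans[OF diff_le_self])

lemma B_Diff: "u \<in> \<B> \<Longrightarrow> u - v \<in> \<B>"
  and B_Un: "u \<in> \<B> \<Longrightarrow> v \<in> \<B> \<Longrightarrow> u \<union> v \<in> \<B>"
  by (auto simp: \<B>_def)

lemma partial_in_homogeneous:
  assumes "i \<in> Y" "f \<in> homogeneous e"
  shows "partial i f \<in> homogeneous (e + \<mu> i)"
  using assms(2) unfolding homogeneous_keys
proof (induction rule: keys_subset_induct)
  case (single s c)
  then obtain \<alpha> u where s: "s = (\<alpha>, u)" "\<alpha> \<in> \<A>" "u \<in> \<B>" "card u mod 2 = e mod 2" by auto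
  consider "i \<in> Y0" | "i \<in> Y1" "i \<in> u" | "i \<in> Y1" "i \<notin> u" using assms(1) by (auto simp: Y_def)
  then show ?case
  proof cases
    case 1
    then show ?thesis using s A_minus_unit[of \<alpha> i] by (simp add: partial_monomial_even)
  next
    case 2
    then have "card u = Suc (card (u - {i}))" using s finite_B by (metis card.remove)
    moreover have "a mod 2 = Suc e mod 2" if "Suc a mod 2 = e mod 2" for a
      using that by presburger
    ultimately have "card (u - {i}) mod 2 = Suc e mod 2" using s(4) by metis
    with 2 s show ?thesis by (simp add: partial_monomial_odd B_Diff)
  next
    case 3
    then show ?thesis using s by (simp add: partial_monomial_odd front_sign_def)
  qed
next
  case (add f g)
  then show ?case using keys_add[of "partial i f" "partial i g"] by (simp add: partial_add) blast
qed simp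

lemma partial_in_O:
  assumes "i \<in> Y" "f \<in> \<O>"
  shows "partial i f \<in> \<O>"
  using assms(2) unfolding \<O>_def mem_Collect_eq
proof (induction rule: keys_subset_induct)
  case (single s c)
  then obtain \<alpha> u where s: "s = (\<alpha>, u)" "\<alpha> \<in> \<A>" "u \<in> \<B>" by auto
  then have "Poly_Mapping.single s c \<in> homogeneous (card u)"
    by (simp add: homogeneous_keys)
  from partial_in_homogeneous[OF assms(1) this] show ?case
    by (simp add: homogeneous_def \<O>_def)
next
  case (add f g)
  then show ?case using keys_add[of "partial i f" "partial i g"] by (simp add: partial_add) blast
qed simp

lemma multi_coeff_eq_0:
  assumes "Poly_Mapping.keys \<alpha> \<subseteq> Y0" "Poly_Mapping.keys \<beta> \<subseteq> Y0" "\<alpha> + \<beta> \<notin> \<A>"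
  shows "multi_coeff \<alpha> \<beta> = 0"
proof -
  have "Poly_Mapping.keys (\<alpha> + \<beta>) \<subseteq> Y0"
    using keys_add[of \<alpha> \<beta>] assms by auto
  with assms(3) show ?thesis
    by (auto simp: \<A>_def lookup_add multi_coeff_def dp_coeff_def intro!: prod_zero)
qed

lemma omult_in_homogeneous:
  assumes "f \<in> homogeneous d" "g \<in> homogeneous e"
  shows "f \<star> g \<in> homogeneous (d + e)"
  using assms(1) unfolding homogeneous_keys[of f]
proof (induction rule: keys_subset_induct)
  case (single s c)
  then obtain \<alpha> u where s: "s = (\<alpha>, u)" "\<alpha> \<in> \<A>" "u \<in> \<B>" "card u mod 2 = d mod 2" by auto
  show ?case
    using assms(2) unfolding homogeneous_keys[of g]
  proof (induction rule: keys_subset_induct)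
    case (single r c')
    then obtain \<beta> v where r: "r = (\<beta>, v)" "\<beta> \<in> \<A>" "v \<in> \<B>" "card v mod 2 = e mod 2" by auto
    note keys = keys_subset_Y0_of_A[OF s(2)] keys_subset_Y0_of_A[OF r(2)]
    show ?case
    proof (cases "\<alpha> + \<beta> \<in> \<A> \<and> u \<inter> v = {}")
      case True
      then have "card (u \<union> v) mod 2 = (d + e) mod 2"
        using s r finite_B by (simp add: card_Un_disjoint) (metis mod_add_cong)
      with True s r keys show ?thesis
        by (simp add: omult_monomials homogeneous_keys B_Un)
    next
      case False
      then have "shuffle_sign u v * multi_coeff \<alpha> \<beta> = (0 :: 'a)"
        using s r keys shuffle_sign_eq_0[OF finite_B finite_B] multi_coeff_eq_0 by (metis mult_eq_0_iff)
      then show ?thesis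
        using s r keys by (simp only: omult_monomials) simp
    qed
  qed (simp_all add: omult_add_right add_in_homogeneous)
qed (simp_all add: omult_add_left add_in_homogeneous)

lemma O_induct [consumes 1, case_names zero homogeneous add]:
  assumes "f \<in> \<O>" and zero: "P 0"
    and homogeneous: "\<And>e f. f \<in> homogeneous e \<Longrightarrow> P f"
    and add: "\<And>f g. f \<in> \<O> \<Longrightarrow> g \<in> \<O> \<Longrightarrow> P f \<Longrightarrow> P g \<Longrightarrow> P (f + g)"
  shows "P f"
  using assms(1) unfolding \<O>_def mem_Collect_eq
proof (induction rule: keys_subset_induct)
  case (single s c)
  then show ?case
    using homogeneous[of "Poly_Mapping.single s c" "card (snd s)"] by (auto simp: homogeneous_keys)
qed (auto intro: zero add simp: \<O>_def)

lemma omult_in_O: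
  assumes "f \<in> \<O>" "g \<in> \<O>"
  shows "f \<star> g \<in> \<O>"
  using assms(1)
proof (induction rule: O_induct)
  case (homogeneous e f)
  show ?case
    using assms(2)
  proof (induction rule: O_induct)
    case (homogeneous d g)
    with \<open>f \<in> homogeneous e\<close> show ?case
      using omult_in_homogeneous homogeneous_subset_O by blast
  qed (simp_all add: omult_add_right add_in_O)
qed (simp_all add: omult_add_left add_in_O)

lemma omult_supercommute:
  assumes "f \<in> homogeneous d" "g \<in> homogeneous e"
  shows "f \<star> g = oscale ((-1) ^ (d * e)) (g \<star> f)"
proof (rule biadditive_eq_on_keys[OF _ _ _ _ _ assms[unfolded homogeneous_keys]])
  fix s r :: mono_ix and a b :: 'a
  assume "s \<in> {(\<alpha>, u). \<alpha> \<in> \<A> \<and> u \<in> \<B> \<and> card u mod 2 = d mod 2}"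
    "r \<in> {(\<alpha>, u). \<alpha> \<in> \<A> \<and> u \<in> \<B> \<and> card u mod 2 = e mod 2}"
  then obtain \<alpha> u \<beta> v where s: "s = (\<alpha>, u)" "\<alpha> \<in> \<A>" "u \<in> \<B>" "card u mod 2 = d mod 2"
    and r: "r = (\<beta>, v)" "\<beta> \<in> \<A>" "v \<in> \<B>" "card v mod 2 = e mod 2" by auto
  have "(card u * card v) mod 2 = (d * e) mod 2"
    using s r by (metis mod_mult_cong)
  then have "even (card u * card v) \<longleftrightarrow> even (d * e)"
    by presburger
  then have "(-1) ^ (card u * card v) = ((-1) ^ (d * e) :: 'a)"
    by (simp only: minus_one_power_iff)
  then have "shuffle_sign u v = ((-1) ^ (d * e) * shuffle_sign v u :: 'a)"
    using shuffle_sign_swap[OF finite_B[OF s(3)] finite_B[OF r(3)]] by metis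
  moreover have "multi_coeff \<alpha> \<beta> = (multi_coeff \<beta> \<alpha> :: 'a)"
    by (simp add: multi_coeff_def dp_coeff_commute)
  ultimately show "Poly_Mapping.single s a \<star> Poly_Mapping.single r b =
      oscale ((-1) ^ (d * e)) (Poly_Mapping.single r b \<star> Poly_Mapping.single s a)"
    using s r by (simp add: omult_monomials keys_subset_Y0_of_A Un_commute add.commute mult_ac)
qed (simp_all add: omult_add_left omult_add_right oscale_add_right)

lemma omult_assoc:
  assumes "f \<in> \<O>" "g \<in> \<O>" "h \<in> \<O>"
  shows "f \<star> g \<star> h = f \<star> (g \<star> h)"
proof (rule biadditive_eq_on_keys[OF _ _ _ _ _ assms(1,2)[unfolded \<O>_def mem_Collect_eq]])
  fix s r :: mono_ix and a b :: 'a
  assume s': "s \<in> \<A> \<times> \<B>" and r': "r \<in> \<A> \<times> \<B>"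
  then obtain \<alpha> u \<beta> v where s: "s = (\<alpha>, u)" "\<alpha> \<in> \<A>" "u \<in> \<B>"
    and r: "r = (\<beta>, v)" "\<beta> \<in> \<A>" "v \<in> \<B>" by auto
  show "Poly_Mapping.single s a \<star> Poly_Mapping.single r b \<star> h =
      Poly_Mapping.single s a \<star> (Poly_Mapping.single r b \<star> h)"
  proof (rule additive_eq_on_keys[OF _ _ _ assms(3)[unfolded \<O>_def mem_Collect_eq]])
    fix q :: mono_ix and c :: 'a
    assume "q \<in> \<A> \<times> \<B>"
    then obtain \<gamma> w where q: "q = (\<gamma>, w)" "\<gamma> \<in> \<A>" "w \<in> \<B>" by auto
    note keys = keys_subset_Y0_of_A[OF s(2)] keys_subset_Y0_of_A[OF r(2)] keys_subset_Y0_of_A[OF q(2)]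
    then have keys': "Poly_Mapping.keys (\<alpha> + \<beta>) \<subseteq> Y0" "Poly_Mapping.keys (\<beta> + \<gamma>) \<subseteq> Y0"
      using keys_add[of \<alpha> \<beta>] keys_add[of \<beta> \<gamma>] by auto
    have "shuffle_sign u v * shuffle_sign (u \<union> v) w = (shuffle_sign v w * shuffle_sign u (v \<union> w) :: 'a)"
    proof -
      have fin: "finite u" "finite v" "finite w" using s r q finite_B by auto
      consider "u \<inter> v \<noteq> {}" | "v \<inter> w \<noteq> {}" | "u \<inter> v = {}" "v \<inter> w = {}" by blast
      then show ?thesis
      proof cases
        case 1
        then have "u \<inter> (v \<union> w) \<noteq> {}" by blast
        with 1 fin show ?thesis by (simp add: shuffle_sign_eq_0)
      next
        case 2
        then have "(u \<union> v) \<inter> w \<noteq> {}" by blast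
        with 2 fin show ?thesis by (simp add: shuffle_sign_eq_0)
      next
        case 3
        with fin show ?thesis by (simp add: shuffle_sign_Un_left shuffle_sign_Un_right)
      qed
    qed
    moreover have "multi_coeff \<alpha> \<beta> * multi_coeff (\<alpha> + \<beta>) \<gamma> =
        (multi_coeff \<beta> \<gamma> * multi_coeff \<alpha> (\<beta> + \<gamma>) :: 'a)"
      by (simp add: multi_coeff_def lookup_add dp_coeff_assoc flip: prod.distrib)
    ultimately have "(shuffle_sign u v * multi_coeff \<alpha> \<beta>) * (shuffle_sign (u \<union> v) w * multi_coeff (\<alpha> + \<beta>) \<gamma>) =
        (shuffle_sign v w * multi_coeff \<beta> \<gamma>) * (shuffle_sign u (v \<union> w) * multi_coeff \<alpha> (\<beta> + \<gamma>) :: 'a)"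
      by algebra
    then have coeff: "a * b * (shuffle_sign u v * multi_coeff \<alpha> \<beta>) * c * 
         (shuffle_sign (u \<union> v) w * multi_coeff (\<alpha> + \<beta>) \<gamma>) =
        a * (b * c * (shuffle_sign v w * multi_coeff \<beta> \<gamma>)) *
         (shuffle_sign u (v \<union> w) * multi_coeff \<alpha> (\<beta> + \<gamma>))"
      by algebra
    show "Poly_Mapping.single s a \<star> Poly_Mapping.single r b \<star> Poly_Mapping.single q c =
        Poly_Mapping.single s a \<star> (Poly_Mapping.single r b \<star> Poly_Mapping.single q c)"
      using s r q keys keys' by (simp add: omult_monomials B_Un Un_assoc add.assoc) (simp only: coeff)
  qed (simp_all add: omult_add_right)
qed (simp_all add: omult_add_left omult_add_right)

lemma partial_supercommute:
  assumes "i \<in> Y" "j \<in> Y" "f \<in> \<O>"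
  shows "partial i (partial j f) = oscale ((-1) ^ (\<mu> i * \<mu> j)) (partial j (partial i f))"
proof (rule additive_eq_on_keys[OF _ _ _ assms(3)[unfolded \<O>_def mem_Collect_eq]])
  fix s :: mono_ix and c :: 'a
  assume "s \<in> \<A> \<times> \<B>"
  then obtain \<alpha> u where s: "s = (\<alpha>, u)" "\<alpha> \<in> \<A>" "u \<in> \<B>" by auto
  have comm: "\<alpha> - Poly_Mapping.single i 1 - Poly_Mapping.single j 1 =
      \<alpha> - Poly_Mapping.single j 1 - Poly_Mapping.single i 1"
    by (rule poly_mapping_eqI) (simp add: lookup_minus)
  have sets: "u - {i} - {j} = u - {j} - {i}" by auto
  consider "i \<in> Y0" "j \<in> Y0" | "i \<in> Y0" "j \<in> Y1" | "i \<in> Y1" "j \<in> Y0" | "i \<in> Y1" "j \<in> Y1"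
    using assms by (auto simp: Y_def)
  then show "partial i (partial j (Poly_Mapping.single s c)) =
      oscale ((-1) ^ (\<mu> i * \<mu> j)) (partial j (partial i (Poly_Mapping.single s c)))"
  proof cases
    case 1
    then show ?thesis
      using s comm by (cases "i = j") (simp_all add: partial_monomial_even lookup_minus lookup_single)
  next
    case 4
    have "front_sign j u * front_sign i (u - {j}) = (- (front_sign i u * front_sign j (u - {i})) :: 'a)"
    proof (cases "i \<in> u \<and> j \<in> u \<and> i \<noteq> j")
      case True
      with s finite_B show ?thesis by (intro front_sign_remove) auto
    next
      case False
      then show ?thesis by (auto simp: front_sign_def)
    qed
    with 4 s sets show ?thesis
      by (simp add: partial_monomial_odd B_Diff mult.assoc flip: single_uminus)
  qed (use s in \<open>simp_all add: partial_monomial_even partial_monomial_odd B_Diff\<close>)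
qed (simp_all add: partial_add oscale_add_right)

end

section \<open>The Leibniz rule in characteristic \<open>p\<close>\<close>

context witt_hamiltonian
begin

lemma multi_coeff_pascal:
  assumes "CHAR('k) = p" "prime p" "i \<in> Y0" "\<alpha> \<in> \<A>" "\<beta> \<in> \<A>"
  shows "(if Poly_Mapping.lookup (\<alpha> + \<beta>) i = 0 then 0 else multi_coeff \<alpha> \<beta>) =
    (if Poly_Mapping.lookup \<alpha> i = 0 then 0 else multi_coeff (\<alpha> - Poly_Mapping.single i 1) \<beta>) +
    (if Poly_Mapping.lookup \<beta> i = 0 then 0
     else multi_coeff \<alpha> (\<beta> - Poly_Mapping.single i 1) :: 'k::field)"
proof -
  define rest :: 'k where "rest = (\<Prod>j\<in>Y0 - {i}.
    dp_coeff (p ^ t j - 1) (Poly_Mapping.lookup \<alpha> j) (Poly_Mapping.lookup \<beta> j))"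
  let ?dp = "dp_coeff (p ^ t i - 1) :: nat \<Rightarrow> nat \<Rightarrow> 'k"
  let ?a = "Poly_Mapping.lookup \<alpha> i" and ?b = "Poly_Mapping.lookup \<beta> i"
  have other: "Poly_Mapping.lookup (\<gamma> - Poly_Mapping.single i 1) j = Poly_Mapping.lookup \<gamma> j"
    if "j \<in> Y0 - {i}" for \<gamma> :: "nat \<Rightarrow>\<^sub>0 nat" and j
    using that by (auto simp: lookup_minus lookup_single when_def)
  have "multi_coeff \<alpha> \<beta> = ?dp ?a ?b * rest"
    "multi_coeff (\<alpha> - Poly_Mapping.single i 1) \<beta> = ?dp (?a - 1) ?b * rest"
    "multi_coeff \<alpha> (\<beta> - Poly_Mapping.single i 1) = ?dp ?a (?b - 1) * rest"
    using assms(3) other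
    by (simp_all add: multi_coeff_def rest_def prod.remove[of Y0 i] lookup_minus)
  moreover have "?a \<le> p ^ t i - 1" "?b \<le> p ^ t i - 1"
    using assms by (auto simp: \<A>_def)
  note dp_coeff_pascal[OF assms(1,2) this]
  ultimately show ?thesis
    by (auto simp: lookup_add distrib_right split: if_splits)
qed

text \<open>
  On monomials, the rule for an even \<open>\<partial>\<^sub>i\<close> is Pascal's rule for the divided-power coefficients. For
  an odd \<open>\<partial>\<^sub>i\<close> it is a comparison of signs, by whether \<open>i\<close> occurs in \<open>u\<close>, in \<open>v\<close>, or in both.
\<close>

lemma partial_leibniz:
  fixes f g :: "'k::field sup"
  assumes "CHAR('k) = p" "prime p" "i \<in> Y" "f \<in> homogeneous d" "g \<in> \<O>"
  shows "partial i (f \<star> g) = partial i f \<star> g + oscale ((-1) ^ (\<mu> i * d)) (f \<star> partial i g)"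
proof (rule biadditive_eq_on_keys[OF _ _ _ _ _ assms(4)[unfolded homogeneous_keys]
      assms(5)[unfolded \<O>_def mem_Collect_eq]])
  fix s r :: mono_ix and a b :: 'k
  assume "s \<in> {(\<alpha>, u). \<alpha> \<in> \<A> \<and> u \<in> \<B> \<and> card u mod 2 = d mod 2}" "r \<in> \<A> \<times> \<B>"
  then obtain \<alpha> u \<beta> v where s: "s = (\<alpha>, u)" "\<alpha> \<in> \<A>" "u \<in> \<B>" "card u mod 2 = d mod 2"
    and r: "r = (\<beta>, v)" "\<beta> \<in> \<A>" "v \<in> \<B>" by auto
  note keys = keys_subset_Y0_of_A[OF s(2)] keys_subset_Y0_of_A[OF r(2)]
  note keys' = keys_subset_Y0_of_A[OF A_minus_unit[OF s(2)]] keys_subset_Y0_of_A[OF A_minus_unit[OF r(2)]]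
  consider "i \<in> Y0" | "i \<in> Y1" using assms(3) by (auto simp: Y_def)
  then show "partial i (Poly_Mapping.single s a \<star> Poly_Mapping.single r b) =
      partial i (Poly_Mapping.single s a) \<star> Poly_Mapping.single r b +
      oscale ((-1) ^ (\<mu> i * d)) (Poly_Mapping.single s a \<star> partial i (Poly_Mapping.single r b))"
  proof cases
    case 1
    let ?e = "Poly_Mapping.single i (1::nat)"
    let ?\<gamma> = "\<alpha> + \<beta> - ?e" and ?c = "a * b * shuffle_sign u v"
    have move_left: "\<alpha> - ?e + \<beta> = ?\<gamma>" if "Poly_Mapping.lookup \<alpha> i \<noteq> 0"
      using that by (intro poly_mapping_eqI) (auto simp: lookup_minus lookup_add lookup_single when_def)
    have move_right: "\<alpha> + (\<beta> - ?e) = ?\<gamma>" if "Poly_Mapping.lookup \<beta> i \<noteq> 0"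
      using that by (intro poly_mapping_eqI) (auto simp: lookup_minus lookup_add lookup_single when_def)
    have "partial i (Poly_Mapping.single s a \<star> Poly_Mapping.single r b) = Poly_Mapping.single (?\<gamma>, u \<union> v)
        (?c * (if Poly_Mapping.lookup (\<alpha> + \<beta>) i = 0 then 0 else multi_coeff \<alpha> \<beta>))"
      using 1 s r keys by (simp add: omult_monomials partial_monomial_even mult.assoc)
    also have "\<dots> = Poly_Mapping.single (?\<gamma>, u \<union> v)
        (?c * (if Poly_Mapping.lookup \<alpha> i = 0 then 0 else multi_coeff (\<alpha> - ?e) \<beta>)) +
      Poly_Mapping.single (?\<gamma>, u \<union> v)
        (?c * (if Poly_Mapping.lookup \<beta> i = 0 then 0 else multi_coeff \<alpha> (\<beta> - ?e)))"
      unfolding multi_coeff_pascal[OF assms(1,2) 1 s(2) r(2)] by (simp only: distrib_left single_add)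
    also have "Poly_Mapping.single (?\<gamma>, u \<union> v)
        (?c * (if Poly_Mapping.lookup \<alpha> i = 0 then 0 else multi_coeff (\<alpha> - ?e) \<beta>)) =
        partial i (Poly_Mapping.single s a) \<star> Poly_Mapping.single r b"
      using 1 s r keys keys' move_left
      by (cases "Poly_Mapping.lookup \<alpha> i = 0") (simp_all add: omult_monomials partial_monomial_even mult.assoc)
    also have "Poly_Mapping.single (?\<gamma>, u \<union> v)
        (?c * (if Poly_Mapping.lookup \<beta> i = 0 then 0 else multi_coeff \<alpha> (\<beta> - ?e))) =
        Poly_Mapping.single s a \<star> partial i (Poly_Mapping.single r b)"
      using 1 s r keys keys' move_right
      by (cases "Poly_Mapping.lookup \<beta> i = 0") (simp_all add: omult_monomials partial_monomial_even mult.assoc)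
    finally show ?thesis using 1 by simp
  next
    case 2
    have fin: "finite u" "finite v" using s r finite_B by auto
    have "even (card u) \<longleftrightarrow> even d" using s(4) by presburger
    then have sign: "(-1) ^ d = ((-1) ^ card u :: 'k)"
      by (simp only: minus_one_power_iff)
    let ?c = "a * b * multi_coeff \<alpha> \<beta>"
    have lhs: "partial i (Poly_Mapping.single s a \<star> Poly_Mapping.single r b) =
        Poly_Mapping.single (\<alpha> + \<beta>, u \<union> v - {i}) (?c * (shuffle_sign u v * front_sign i (u \<union> v)))"
      using 2 s r keys by (simp add: omult_monomials partial_monomial_odd B_Un mult_ac)
    have rhs: "partial i (Poly_Mapping.single s a) \<star> Poly_Mapping.single r b =
        Poly_Mapping.single (\<alpha> + \<beta>, (u - {i}) \<union> v)
          (?c * (front_sign i u * shuffle_sign (u - {i}) v))"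
      "oscale ((-1) ^ (\<mu> i * d)) (Poly_Mapping.single s a \<star> partial i (Poly_Mapping.single r b)) =
        Poly_Mapping.single (\<alpha> + \<beta>, u \<union> (v - {i}))
          (?c * ((-1) ^ card u * (front_sign i v * shuffle_sign u (v - {i}))))"
      using 2 s r keys by (simp_all add: omult_monomials partial_monomial_odd B_Diff sign mult_ac)
    consider "i \<in> u" "i \<notin> v" | "i \<notin> u" "i \<in> v" | "i \<in> u" "i \<in> v" | "i \<notin> u" "i \<notin> v" by blast
    then show ?thesis
    proof cases
      case 1
      then have "u \<union> v - {i} = (u - {i}) \<union> v" "front_sign i v = (0 :: 'k)"
        by (auto simp: front_sign_def)
      then show ?thesis unfolding lhs rhs front_sign_Un_left[OF fin 1] by simp
    next
      case 2
      then have "u \<union> v - {i} = u \<union> (v - {i})" "front_sign i u = (0 :: 'k)"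
        by (auto simp: front_sign_def)
      then show ?thesis unfolding lhs rhs front_sign_Un_right[OF fin 2] by simp
    next
      case 3
      then have "(u - {i}) \<union> v = u \<union> (v - {i})" "shuffle_sign u v = (0 :: 'k)"
        using fin by (auto intro!: shuffle_sign_eq_0)
      then show ?thesis unfolding lhs rhs front_sign_both[OF fin 3] by (simp flip: single_add)
    next
      case 4
      then show ?thesis unfolding lhs rhs by (simp add: front_sign_def)
    qed
  qed
qed (simp_all add: omult_add_left omult_add_right partial_add oscale_add_right)

lemma funpow_leibniz:
  fixes d :: "'k::field sup \<Rightarrow> 'k sup"
  assumes add: "\<And>f g. d (f + g) = d f + d g" and closed: "\<And>f. f \<in> \<O> \<Longrightarrow> d f \<in> \<O>"
    and leibniz: "\<And>f g. f \<in> \<O> \<Longrightarrow> g \<in> \<O> \<Longrightarrow> d (f \<star> g) = d f \<star> g + f \<star> d g"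
    and "f \<in> \<O>" "g \<in> \<O>"
  shows "(d ^^ N) (f \<star> g) = (\<Sum>k\<le>N. oscale (of_nat (N choose k)) ((d ^^ k) f \<star> (d ^^ (N - k)) g))"
  using assms(4,5)
proof (induction N arbitrary: f g)
  case (Suc N)
  have pow_add: "(d ^^ k) (f + g) = (d ^^ k) f + (d ^^ k) g" for k f g
    by (induction k) (simp_all add: add)
  define T where "T k = (d ^^ k) f \<star> (d ^^ (Suc N - k)) g" for k
  have "(d ^^ Suc N) (f \<star> g) = (d ^^ N) (d f \<star> g) + (d ^^ N) (f \<star> d g)"
    unfolding funpow_Suc_right using Suc.prems by (simp add: leibniz pow_add)
  also have "(d ^^ N) (d f \<star> g) = (\<Sum>k\<le>N. oscale (of_nat (N choose k)) (T (Suc k)))"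
    unfolding T_def using Suc closed by (simp add: funpow_swap1)
  also have "(d ^^ N) (f \<star> d g) = (\<Sum>k\<le>N. oscale (of_nat (N choose k)) (T k))"
    unfolding T_def using Suc closed by (simp add: funpow_swap1 Suc_diff_le)
  also have "\<dots> = (\<Sum>k\<le>Suc N. oscale (of_nat (N choose k)) (T k))"
    by (simp add: binomial_eq_0)
  also have "\<dots> = T 0 + (\<Sum>k\<le>N. oscale (of_nat (N choose Suc k)) (T (Suc k)))"
    by (subst sum.atMost_Suc_shift) simp
  also have "(\<Sum>k\<le>N. oscale (of_nat (N choose k)) (T (Suc k))) + \<dots> =
      T 0 + (\<Sum>k\<le>N. oscale (of_nat (Suc N choose Suc k)) (T (Suc k)))"
    by (simp add: oscale_add_left sum.distrib algebra_simps)
  also have "\<dots> = (\<Sum>k\<le>Suc N. oscale (of_nat (Suc N choose k)) (T k))"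
    by (subst sum.atMost_Suc_shift) simp
  finally show ?case unfolding T_def .
qed simp

lemma partial_funpow_closed:
  assumes "i \<in> Y0"
  shows "f \<in> homogeneous e \<Longrightarrow> (partial i ^^ N) f \<in> homogeneous e"
    and "f \<in> \<O> \<Longrightarrow> (partial i ^^ N) f \<in> \<O>"
proof -
  have i: "i \<in> Y" using assms by (simp add: Y_def)
  show "f \<in> homogeneous e \<Longrightarrow> (partial i ^^ N) f \<in> homogeneous e"
    using assms partial_in_homogeneous[OF i, of _ e] by (induction N) auto
  show "f \<in> \<O> \<Longrightarrow> (partial i ^^ N) f \<in> \<O>"
    using partial_in_O[OF i] by (induction N) auto
qed

lemma partial_funpow_linear:
  "(partial i ^^ N) (f + g) = (partial i ^^ N) f + (partial i ^^ N) g"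
  "(partial i ^^ N) (f - g) = (partial i ^^ N) f - (partial i ^^ N) g"
  "(partial i ^^ N) (oscale c f) = oscale c ((partial i ^^ N) f)"
  "(partial i ^^ N) 0 = 0"
  by (induction N) (simp_all add: partial_add partial_diff partial_oscale)

lemma partial_funpow_sum: "(partial i ^^ N) (\<Sum>x\<in>X. f x) = (\<Sum>x\<in>X. (partial i ^^ N) (f x))"
  by (induction X rule: infinite_finite_induct) (simp_all add: partial_funpow_linear)

lemma partial_funpow_commute:
  assumes "i \<in> Y0" "k \<in> Y" "f \<in> \<O>"
  shows "(partial i ^^ N) (partial k f) = partial k ((partial i ^^ N) f)"
proof (induction N)
  case (Suc N)
  have "i \<in> Y" using assms by (simp add: Y_def)
  with Suc assms partial_supercommute[of i k "(partial i ^^ N) f"] show ?case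
    by (simp add: partial_funpow_closed)
qed simp

text \<open>
  The \<open>p\<^sup>q\<close>-th power of a derivation is a derivation in characteristic \<open>p\<close>: all middle binomial
  coefficients in the iterated Leibniz rule vanish.
\<close>

lemma partial_prime_power_leibniz:
  fixes f g :: "'k::field sup"
  assumes "CHAR('k) = p" "prime p" "i \<in> Y0" "f \<in> \<O>" "g \<in> \<O>"
  shows "(partial i ^^ (p ^ q)) (f \<star> g) =
    (partial i ^^ (p ^ q)) f \<star> g + f \<star> (partial i ^^ (p ^ q)) g"
proof -
  have i: "i \<in> Y" using assms by (simp add: Y_def)
  have leibniz: "partial i (f \<star> g) = partial i f \<star> g + f \<star> partial i g"
    if "f \<in> \<O>" "g \<in> \<O>" for f g :: "'k sup"
    using that(1)
  proof (induction rule: O_induct)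
    case (homogeneous e f)
    with partial_leibniz[OF assms(1,2) i homogeneous that(2)] assms(3) show ?case by simp
  qed (simp_all add: omult_add_left partial_add)
  let ?N = "p ^ q"
  let ?T = "\<lambda>k. oscale (of_nat (?N choose k)) ((partial i ^^ k) f \<star> (partial i ^^ (?N - k)) g)"
  have pos: "?N > 0" using assms(2) by (simp add: prime_gt_0_nat)
  have "(partial i ^^ ?N) (f \<star> g) = (\<Sum>k\<le>?N. ?T k)"
    using assms(4,5) leibniz partial_in_O[OF i] by (intro funpow_leibniz) (auto simp: partial_add)
  also have "\<dots> = (\<Sum>k\<in>{0, ?N}. ?T k)"
  proof (rule sum.mono_neutral_right)
    show "\<forall>k\<in>{..?N} - {0, ?N}. ?T k = 0"
    proof
      fix k assume "k \<in> {..?N} - {0, ?N}"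
      then have "p dvd (?N choose k)"
        using assms(2) by (intro prime_dvd_prime_power_choose) auto
      then have "of_nat (?N choose k) = (0 :: 'k)"
        using assms(1) by (simp add: of_nat_eq_0_iff_char_dvd)
      then show "?T k = 0" by simp
    qed
  qed auto
  also have "\<dots> = (partial i ^^ ?N) f \<star> g + f \<star> (partial i ^^ ?N) g"
    using pos by (simp add: add.commute)
  finally show ?thesis .
qed

end

section \<open>The even part of the Witt superalgebra\<close>

context witt_hamiltonian
begin

lemma W_even_coeff: "X \<in> \<W> \<Longrightarrow> k \<in> Y \<Longrightarrow> Poly_Mapping.lookup X k \<in> homogeneous (\<mu> k)"
  and W_even_outside: "X \<in> \<W> \<Longrightarrow> k \<notin> Y \<Longrightarrow> Poly_Mapping.lookup X k = 0"
  by (auto simp: \<W>_def W_def homogeneous_def in_keys_iff)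

lemma W_evenI:
  assumes "\<And>k. k \<in> Y \<Longrightarrow> Poly_Mapping.lookup X k \<in> homogeneous (\<mu> k)"
    and "\<And>k. k \<notin> Y \<Longrightarrow> Poly_Mapping.lookup X k = 0"
  shows "X \<in> \<W>"
  using assms by (auto simp: \<W>_def W_def homogeneous_def in_keys_iff)

lemma W_even_coeff_in_O: "X \<in> \<W> \<Longrightarrow> Poly_Mapping.lookup X k \<in> \<O>"
  using W_even_coeff[of X k] W_even_outside[of X k] homogeneous_subset_O by (cases "k \<in> Y") auto

lemma hcomp_homogeneous:
  assumes "f \<in> homogeneous d" "e < 2"
  shows "hcomp e f = (if e = d mod 2 then f else 0)"
proof (rule poly_mapping_eqI)
  fix s :: mono_ix
  have "hcomp e f = (\<Sum>s \<in> {s \<in> Poly_Mapping.keys f. card (snd s) mod 2 = e}.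
      Poly_Mapping.single s (Poly_Mapping.lookup f s))"
    by (simp add: hcomp_def case_prod_beta)
  then have "Poly_Mapping.lookup (hcomp e f) s =
      (if card (snd s) mod 2 = e then Poly_Mapping.lookup f s else 0)"
    by (auto simp: lookup_sum lookup_single when_def in_keys_iff)
  moreover have "Poly_Mapping.lookup f s = 0 \<or> card (snd s) mod 2 = d mod 2"
    using assms by (cases s) (auto simp: homogeneous_keys in_keys_iff subset_iff)
  ultimately show "Poly_Mapping.lookup (hcomp e f) s =
      Poly_Mapping.lookup (if e = d mod 2 then f else 0) s"
    by auto
qed

lemma act_zero_right [simp]: "act X 0 = 0"
  by (simp add: act_def)

text \<open>
  For even \<open>D\<close> and \<open>E\<close> all signs in the bracket are trivial. So the coefficients of \<open>[D, E]\<close> are those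
  of a commutator of vector fields.
\<close>

lemma lookup_bracket:
  assumes "D \<in> \<W>" "E \<in> \<W>"
  shows "Poly_Mapping.lookup (bracket D E) k =
    act D (Poly_Mapping.lookup E k) - act E (Poly_Mapping.lookup D k)"
proof -
  let ?D = "Poly_Mapping.lookup D" and ?E = "Poly_Mapping.lookup E"
  have terms: "(\<Sum>d\<in>{0, 1}. \<Sum>e\<in>{0, 1}. hbracket d (hcomp d (?D i)) i e (hcomp e (?E j)) j) =
      Poly_Mapping.single j (?D i \<star> partial i (?E j)) - Poly_Mapping.single i (?E j \<star> partial j (?D i))"
    if "i \<in> Y" "j \<in> Y" for i j
  proof -
    have zero: "hbracket d 0 i e b j = 0" "hbracket d a i e 0 j = 0" for d e and a b :: "'a sup"
      by (auto simp: hbracket_def intro!: poly_mapping_eqI simp: lookup_minus)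
    have wscale_one: "wscale 1 Z = Z" for Z :: "'a wit"
      by (rule poly_mapping_eqI) simp
    have parity: "\<mu> i \<in> {0, 1}" "\<mu> j \<in> {0, 1}"
      by (auto simp: \<mu>_def)
    then have mod2: "\<mu> i mod 2 = \<mu> i" "\<mu> j mod 2 = \<mu> j" by auto
    have "hbracket d (hcomp d (?D i)) i e (hcomp e (?E j)) j =
        (if e = \<mu> j then if d = \<mu> i then hbracket (\<mu> i) (?D i) i (\<mu> j) (?E j) j else 0 else 0)"
      if "d \<in> {0, 1}" "e \<in> {0, 1}" for d e
    proof -
      have "d < 2" "e < 2" using that by auto
      then have "hcomp d (?D i) = (if d = \<mu> i then ?D i else 0)"
        "hcomp e (?E j) = (if e = \<mu> j then ?E j else 0)"
        using hcomp_homogeneous[OF W_even_coeff[OF assms(1) \<open>i \<in> Y\<close>], of d]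
          hcomp_homogeneous[OF W_even_coeff[OF assms(2) \<open>j \<in> Y\<close>], of e]
        by (simp_all only: mod2)
      then show ?thesis by (simp only: zero if_True if_False split: if_split) blast
    qed
    then have "(\<Sum>d\<in>{0, 1}. \<Sum>e\<in>{0, 1}. hbracket d (hcomp d (?D i)) i e (hcomp e (?E j)) j) =
        (\<Sum>d\<in>{0, 1}. \<Sum>e\<in>{0, 1}.
          if e = \<mu> j then if d = \<mu> i then hbracket (\<mu> i) (?D i) i (\<mu> j) (?E j) j else 0 else 0)"
      by (intro sum.cong refl)
    also have "\<dots> = hbracket (\<mu> i) (?D i) i (\<mu> j) (?E j) j"
      by (simp only: sum.delta finite.intros parity if_True)
    also have "hbracket (\<mu> i) (?D i) i (\<mu> j) (?E j) j =
        Poly_Mapping.single j (?D i \<star> partial i (?E j)) - Poly_Mapping.single i (?E j \<star> partial j (?D i))"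
      by (simp add: hbracket_def wscale_one flip: mult_2)
    finally show ?thesis .
  qed
  have "bracket D E = (\<Sum>i\<in>Y. \<Sum>j\<in>Y. Poly_Mapping.single j (?D i \<star> partial i (?E j)) -
      Poly_Mapping.single i (?E j \<star> partial j (?D i)))"
    unfolding bracket_def by (intro sum.cong refl terms)
  then have "Poly_Mapping.lookup (bracket D E) k = (\<Sum>i\<in>Y. \<Sum>j\<in>Y.
      Poly_Mapping.lookup (Poly_Mapping.single j (?D i \<star> partial i (?E j)) -
        Poly_Mapping.single i (?E j \<star> partial j (?D i))) k)"
    by (simp only: lookup_sum)
  also have "\<dots> = (\<Sum>i\<in>Y. \<Sum>j\<in>Y. if j = k then ?D i \<star> partial i (?E j) else 0) -
      (\<Sum>j\<in>Y. \<Sum>i\<in>Y. if i = k then ?E j \<star> partial j (?D i) else 0)"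
    by (subst (3) sum.swap) (simp add: lookup_minus lookup_single when_def sum_subtractf)
  also have "\<dots> = act D (?E k) - act E (?D k)"
    using W_even_outside[OF assms(1)] W_even_outside[OF assms(2)]
    by (cases "k \<in> Y") (simp_all add: act_def)
  finally show ?thesis .
qed

lemma act_in_homogeneous:
  assumes "X \<in> \<W>" "f \<in> homogeneous e"
  shows "act X f \<in> homogeneous e"
  unfolding act_def
proof (rule sum_in_homogeneous)
  fix k assume k: "k \<in> Y"
  have "Poly_Mapping.lookup X k \<star> partial k f \<in> homogeneous (\<mu> k + (e + \<mu> k))"
    using assms k by (intro omult_in_homogeneous W_even_coeff partial_in_homogeneous)
  moreover have "(\<mu> k + (e + \<mu> k)) mod 2 = e mod 2" by presburger
  ultimately show "Poly_Mapping.lookup X k \<star> partial k f \<in> homogeneous e"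
    using homogeneous_cong by blast
qed

lemma act_leibniz:
  fixes f g :: "'k::field sup"
  assumes "CHAR('k) = p" "prime p" "X \<in> \<W>" "f \<in> homogeneous d" "g \<in> \<O>"
  shows "act X (f \<star> g) = act X f \<star> g + f \<star> act X g"
proof -
  have "Poly_Mapping.lookup X k \<star> partial k (f \<star> g) =
      Poly_Mapping.lookup X k \<star> partial k f \<star> g + f \<star> (Poly_Mapping.lookup X k \<star> partial k g)"
    if k: "k \<in> Y" for k
  proof -
    let ?a = "Poly_Mapping.lookup X k"
    have O: "?a \<in> \<O>" "f \<in> \<O>" "partial k f \<in> \<O>" "partial k g \<in> \<O>"
      using assms(3-5) k homogeneous_subset_O[of d] by (auto simp: W_even_coeff_in_O partial_in_O)
    have "?a \<star> f = oscale ((-1) ^ (\<mu> k * d)) (f \<star> ?a)"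
      using assms k by (intro omult_supercommute W_even_coeff)
    then have "oscale ((-1) ^ (\<mu> k * d)) (?a \<star> f) = f \<star> ?a"
      by (simp flip: power_add mult_2)
    then have "oscale ((-1) ^ (\<mu> k * d)) (?a \<star> (f \<star> partial k g)) = f \<star> (?a \<star> partial k g)"
      using O by (simp flip: omult_assoc omult_oscale_left)
    with O assms(5) show ?thesis
      by (simp add: partial_leibniz[OF assms(1,2) k assms(4,5)] omult_add_right omult_oscale_right
          omult_assoc)
  qed
  then show ?thesis
    by (simp add: act_def omult_sum_left omult_sum_right sum.distrib)
qed

lemma lookup_omod: "Poly_Mapping.lookup (omod a X) k = a \<star> Poly_Mapping.lookup X k"
  by (simp add: omod_def Poly_Mapping.map.rep_eq when_def)

lemma act_omod:
  assumes "a \<in> \<O>" "X \<in> \<W>" "f \<in> \<O>"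
  shows "act (omod a X) f = a \<star> act X f"
  using assms
  by (simp add: act_def lookup_omod omult_sum_right omult_assoc W_even_coeff_in_O partial_in_O)

lemma one_omult:
  assumes "f \<in> homogeneous e"
  shows "xmon 0 {} \<star> f = f"
proof -
  have "(xmon 0 {} :: 'a sup) \<in> homogeneous 0"
    by (simp add: homogeneous_keys xmon_def \<A>_def \<B>_def)
  with assms have "xmon 0 {} \<star> f = f \<star> xmon 0 {}"
    using omult_supercommute[of "xmon 0 {}" 0 f e] by simp
  then show ?thesis
    using omult_one[of f] assms homogeneous_subset_O[of e] by auto
qed

lemma pd_in_W_even: "i \<in> Y0 \<Longrightarrow> pd i \<in> \<W>"
  by (intro W_evenI)
    (auto simp: pd_def lookup_single when_def homogeneous_keys xmon_def \<A>_def \<B>_def Y_def)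

lemma ad_pd:
  assumes "i \<in> Y0" "X \<in> \<W>"
  shows "Poly_Mapping.lookup (ad (pd i) X) k = partial i (Poly_Mapping.lookup X k)"
proof -
  have i: "i \<in> Y" using assms by (simp add: Y_def)
  obtain e where e: "Poly_Mapping.lookup X k \<in> homogeneous e"
    using W_even_coeff[OF assms(2), of k] W_even_outside[OF assms(2), of k]
    by (cases "k \<in> Y") (auto intro: that[of 0])
  have "act (pd i) (Poly_Mapping.lookup X k) =
      (\<Sum>j\<in>Y. if j = i then xmon 0 {} \<star> partial i (Poly_Mapping.lookup X k) else 0)"
    unfolding act_def by (intro sum.cong) (auto simp: pd_def lookup_single when_def)
  also have "\<dots> = partial i (Poly_Mapping.lookup X k)"
    using i one_omult[OF partial_in_homogeneous[OF i e]] by simp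
  finally have act_pd: "act (pd i) (Poly_Mapping.lookup X k) = partial i (Poly_Mapping.lookup X k)" .
  have "partial j (xmon 0 {}) = (0 :: 'a sup)" for j
    by (simp add: partial_xmon mono_deriv_def)
  then have "act X (Poly_Mapping.lookup (pd i) k) = 0"
    by (auto simp: act_def pd_def lookup_single when_def intro!: sum.neutral)
  with act_pd show ?thesis
    by (simp add: ad_def lookup_bracket[OF pd_in_W_even[OF assms(1)] assms(2)])
qed

lemma ad_pd_funpow:
  assumes "i \<in> Y0" "X \<in> \<W>"
  shows "(ad (pd i) ^^ N) X \<in> \<W>"
    and "Poly_Mapping.lookup ((ad (pd i) ^^ N) X) k = (partial i ^^ N) (Poly_Mapping.lookup X k)"
proof -
  have "(ad (pd i) ^^ N) X \<in> \<W> \<and>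
      (\<forall>k. Poly_Mapping.lookup ((ad (pd i) ^^ N) X) k = (partial i ^^ N) (Poly_Mapping.lookup X k))"
  proof (induction N)
    case (Suc N)
    then have lookup: "Poly_Mapping.lookup ((ad (pd i) ^^ Suc N) X) k =
        (partial i ^^ Suc N) (Poly_Mapping.lookup X k)" for k
      using ad_pd[OF assms(1), of "(ad (pd i) ^^ N) X" k] by simp
    have "(ad (pd i) ^^ Suc N) X \<in> \<W>"
    proof (rule W_evenI)
      fix k assume "k \<in> Y"
      then show "Poly_Mapping.lookup ((ad (pd i) ^^ Suc N) X) k \<in> homogeneous (\<mu> k)"
        unfolding lookup using assms by (intro partial_funpow_closed W_even_coeff)
    next
      fix k assume "k \<notin> Y"
      then have "Poly_Mapping.lookup X k = 0" by (rule W_even_outside[OF assms(2)])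
      then show "Poly_Mapping.lookup ((ad (pd i) ^^ Suc N) X) k = 0"
        unfolding lookup by (simp only: partial_funpow_linear)
    qed
    with lookup show ?case by blast
  qed (use assms in simp)
  then show "(ad (pd i) ^^ N) X \<in> \<W>"
    and "Poly_Mapping.lookup ((ad (pd i) ^^ N) X) k = (partial i ^^ N) (Poly_Mapping.lookup X k)"
    by blast+
qed

text \<open>
  This is the derivation rule of \<open>(ad \<partial>\<^sub>i)\<close> to the power \<open>p\<^sup>q\<close>, read off on coefficients.
\<close>

lemma partial_prime_power_act:
  fixes f :: "'k::field sup"
  assumes "CHAR('k) = p" "prime p" "i \<in> Y0" "X \<in> \<W>" "f \<in> \<O>"
  shows "(partial i ^^ (p ^ q)) (act X f) =
    act ((ad (pd i) ^^ (p ^ q)) X) f + act X ((partial i ^^ (p ^ q)) f)"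
  unfolding act_def sum.distrib[symmetric] partial_funpow_sum
proof (rule sum.cong)
  fix k assume k: "k \<in> Y"
  with assms have "Poly_Mapping.lookup X k \<in> \<O>" "partial k f \<in> \<O>"
    by (simp_all add: W_even_coeff_in_O partial_in_O)
  from partial_prime_power_leibniz[OF assms(1-3) this]
  show "(partial i ^^ (p ^ q)) (Poly_Mapping.lookup X k \<star> partial k f) =
      Poly_Mapping.lookup ((ad (pd i) ^^ (p ^ q)) X) k \<star> partial k f +
      Poly_Mapping.lookup X k \<star> partial k ((partial i ^^ (p ^ q)) f)"
    using assms k by (simp add: ad_pd_funpow partial_funpow_commute)
qed simp

end

section \<open>The Hamiltonian superalgebra\<close>

context witt_hamiltonian
begin

lemma prime_ix_in_Y: "k \<in> Y \<Longrightarrow> prime_ix k \<in> Y"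
  and prime_ix_involution: "k \<in> Y \<Longrightarrow> prime_ix (prime_ix k) = k"
  and mu_prime_ix: "k \<in> Y \<Longrightarrow> \<mu> (prime_ix k) = \<mu> k"
  by (auto simp: prime_ix_def Y_def Y0_def Y1_def \<mu>_def)

lemma prime_ix_odd: "k \<in> Y1 \<Longrightarrow> prime_ix k = k"
  by (simp add: prime_ix_def)

lemma tau_prime_ix: "k \<in> Y \<Longrightarrow> \<tau> (prime_ix k) * (-1) ^ \<mu> k = (- \<tau> k :: 'k::field)"
  by (auto simp: prime_ix_def Y_def Y0_def Y1_def \<mu>_def \<tau>_def)

lemma sum_prime_ix: "(\<Sum>k\<in>Y. f (prime_ix k)) = (\<Sum>k\<in>Y. f k)"
  by (rule sum.reindex_bij_witness[of _ prime_ix prime_ix])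
    (auto simp: prime_ix_in_Y prime_ix_involution)

lemma lookup_DH:
  assumes "f \<in> homogeneous 0"
  shows "Poly_Mapping.lookup (DH f) k =
    (if k \<in> Y then oscale (\<tau> (prime_ix k)) (partial (prime_ix k) f) else 0)"
proof -
  have "hcomp 0 f = f" "hcomp 1 f = 0"
    using hcomp_homogeneous[OF assms] by simp_all
  then have "Poly_Mapping.lookup (DH f) k =
      (\<Sum>i\<in>Y. if prime_ix i = k then oscale (\<tau> i) (partial i f) else 0)"
    by (auto simp: DH_def lookup_add lookup_sum lookup_single when_def intro!: sum.cong)
  also have "\<dots> = (\<Sum>i\<in>Y. if i = k then oscale (\<tau> (prime_ix i)) (partial (prime_ix i) f) else 0)"
    by (subst sum_prime_ix[symmetric]) (auto simp: prime_ix_involution intro!: sum.cong)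
  finally show ?thesis by simp
qed

lemma DH_in_W_even:
  assumes "f \<in> homogeneous 0"
  shows "DH f \<in> \<W>"
proof (rule W_evenI)
  fix k assume k: "k \<in> Y"
  from partial_in_homogeneous[OF prime_ix_in_Y[OF k] assms] k
  show "Poly_Mapping.lookup (DH f) k \<in> homogeneous (\<mu> k)"
    by (simp add: lookup_DH[OF assms] mu_prime_ix oscale_in_homogeneous)
qed (simp add: lookup_DH[OF assms])

lemma DH_add:
  "f \<in> homogeneous 0 \<Longrightarrow> g \<in> homogeneous 0 \<Longrightarrow> DH (f + g) = DH f + DH g"
  by (rule poly_mapping_eqI)
    (simp add: lookup_DH add_in_homogeneous lookup_add partial_add oscale_add_right)

lemma DH_oscale: "f \<in> homogeneous 0 \<Longrightarrow> DH (oscale c f) = wscale c (DH f)"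
  by (rule poly_mapping_eqI)
    (simp add: lookup_DH oscale_in_homogeneous partial_oscale mult.commute)

definition hamiltonians :: "'k::field sup set" where
  "hamiltonians = {f \<in> homogeneous 0. Poly_Mapping.lookup f (\<pi>, \<omega>) = 0}"

lemma hamiltonians_keys:
  "f \<in> hamiltonians \<longleftrightarrow> Poly_Mapping.keys f \<subseteq> \<A> \<times> \<B>even - {(\<pi>, \<omega>)}"
  by (auto simp: hamiltonians_def homogeneous_keys \<B>even_def even_iff_mod_2_eq_zero in_keys_iff)

lemma H_eq_image: "\<H> = DH ` hamiltonians"
proof
  interpret vector_space "wscale :: 'k::field \<Rightarrow> 'k wit \<Rightarrow> 'k wit"
    by (rule vector_space_wscale)
  let ?G = "{DH (xmon \<alpha> u) :: 'k wit | \<alpha> u. \<alpha> \<in> \<A> \<and> u \<in> \<B>even \<and> (\<alpha>, u) \<noteq> (\<pi>, \<omega>)}"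
  show "(\<H> :: 'k wit set) \<subseteq> DH ` hamiltonians"
    unfolding \<H>_def
  proof (rule span_minimal)
    show "?G \<subseteq> DH ` hamiltonians"
      by (auto simp: hamiltonians_keys xmon_def)
    show "subspace (DH ` hamiltonians :: 'k wit set)"
    proof (rule subspaceI)
      have "DH 0 = (0 :: 'k wit)"
        by (rule poly_mapping_eqI) (simp add: lookup_DH)
      then show "(0 :: 'k wit) \<in> DH ` hamiltonians"
        by (intro image_eqI[of _ _ 0]) (auto simp: hamiltonians_def)
    next
      fix X Y :: "'k wit"
      assume "X \<in> DH ` hamiltonians" "Y \<in> DH ` hamiltonians"
      then obtain f g where "f \<in> hamiltonians" "g \<in> hamiltonians" "X = DH f" "Y = DH g" by blast
      then show "X + Y \<in> DH ` hamiltonians"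
        by (intro image_eqI[of _ _ "f + g"])
          (auto simp: hamiltonians_def DH_add add_in_homogeneous lookup_add)
    next
      fix c and X :: "'k wit"
      assume "X \<in> DH ` hamiltonians"
      then obtain f where "f \<in> hamiltonians" "X = DH f" by blast
      then show "wscale c X \<in> DH ` hamiltonians"
        by (intro image_eqI[of _ _ "oscale c f"])
          (auto simp: hamiltonians_def DH_oscale oscale_in_homogeneous)
    qed
  qed
  have "DH f \<in> \<H>" if "f \<in> hamiltonians" for f :: "'k sup"
    using that unfolding hamiltonians_keys
  proof (induction rule: keys_subset_induct)
    case zero
    have "DH 0 = (0 :: 'k wit)"
      by (rule poly_mapping_eqI) (simp add: lookup_DH)
    then show ?case by (simp add: \<H>_def span_zero)
  next
    case (single s c)
    then obtain \<alpha> u where s: "s = (\<alpha>, u)" "\<alpha> \<in> \<A>" "u \<in> \<B>even" "(\<alpha>, u) \<noteq> (\<pi>, \<omega>)" by auto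
    then have "(xmon \<alpha> u :: 'k sup) \<in> homogeneous 0"
      by (auto simp: xmon_def homogeneous_keys \<B>even_def)
    from DH_oscale[OF this, of c] have "DH (Poly_Mapping.single s c) = wscale c (DH (xmon \<alpha> u))"
      by (simp add: s xmon_def)
    moreover have "DH (xmon \<alpha> u) \<in> ?G" using s by blast
    then have "wscale c (DH (xmon \<alpha> u)) \<in> \<H>"
      unfolding \<H>_def by (intro span_scale span_base)
    ultimately show ?case by simp
  next
    case (add f g)
    then have "f \<in> homogeneous 0" "g \<in> homogeneous 0"
      using hamiltonians_keys by (auto simp: hamiltonians_def)
    with add show ?case
      by (simp add: DH_add \<H>_def span_add)
  qed
  then show "DH ` hamiltonians \<subseteq> (\<H> :: 'k wit set)" by blast
qed

definition poisson :: "'k::field sup \<Rightarrow> 'k sup \<Rightarrow> 'k sup" where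
  "poisson f g = act (DH f) g"

lemma poisson_eq:
  assumes "f \<in> homogeneous 0"
  shows "poisson f g =
    (\<Sum>k\<in>Y. oscale (\<tau> (prime_ix k)) (partial (prime_ix k) f \<star> partial k g))"
  by (simp add: poisson_def act_def lookup_DH[OF assms] omult_oscale_left)

text \<open>
  Apply \<open>\<partial>\<^sub>j\<close> to the Poisson bracket of \<open>f\<close> and \<open>g\<close>. The terms that differentiate \<open>g\<close> twice give
  the action of \<open>D\<^sub>H(f)\<close> on \<open>\<partial>\<^sub>j g\<close>. Those that differentiate \<open>f\<close> twice give minus the action of
  \<open>D\<^sub>H(g)\<close> on \<open>\<partial>\<^sub>j f\<close>, after \<open>k\<close> and \<open>k'\<close> are exchanged.
\<close>

lemma partial_poisson:
  fixes f g :: "'k::field sup"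
  assumes "CHAR('k) = p" "prime p" "f \<in> homogeneous 0" "g \<in> homogeneous 0" "j \<in> Y"
  shows "partial j (poisson f g) = act (DH f) (partial j g) - act (DH g) (partial j f)"
proof -
  have O: "f \<in> \<O>" "g \<in> \<O>" using assms homogeneous_subset_O by auto
  let ?s = "\<lambda>k. (-1) ^ (\<mu> k * \<mu> j) :: 'k"
  have twice_f: "oscale (\<tau> (prime_ix k)) (partial j (partial (prime_ix k) f) \<star> partial k g) =
      - oscale (\<tau> k) (partial k g \<star> partial (prime_ix k) (partial j f))" if k: "k \<in> Y" for k
  proof -
    let ?h = "partial (prime_ix k) (partial j f)"
    have h: "?h \<in> homogeneous (0 + \<mu> j + \<mu> k)"
      using partial_in_homogeneous[OF prime_ix_in_Y[OF k] partial_in_homogeneous[OF assms(5,3)]] k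
      by (simp add: mu_prime_ix)
    have g: "partial k g \<in> homogeneous (\<mu> k)"
      using partial_in_homogeneous[OF k assms(4)] by simp
    have "partial j (partial (prime_ix k) f) = oscale (?s k) ?h"
      using partial_supercommute[OF assms(5) prime_ix_in_Y[OF k] O(1)] k
      by (simp add: mu_prime_ix mult.commute)
    also have "\<dots> \<star> partial k g = oscale (?s k * (-1) ^ ((\<mu> j + \<mu> k) * \<mu> k)) (partial k g \<star> ?h)"
      using omult_supercommute[OF h g] by (simp add: omult_oscale_left)
    also have "?s k * (-1) ^ ((\<mu> j + \<mu> k) * \<mu> k) = (-1) ^ \<mu> k"
      by (simp add: \<mu>_def)
    finally show ?thesis
      using tau_prime_ix[OF k, where ?'k = 'k] by simp
  qed
  have twice_g: "oscale (\<tau> (prime_ix k)) (oscale (?s k) (partial (prime_ix k) f \<star> partial j (partial k g))) =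
      oscale (\<tau> (prime_ix k)) (partial (prime_ix k) f \<star> partial k (partial j g))" if k: "k \<in> Y" for k
  proof -
    have "partial j (partial k g) = oscale (?s k) (partial k (partial j g))"
      using partial_supercommute[OF assms(5) k O(2)] by (simp add: mult.commute)
    then show ?thesis
      by (simp add: omult_oscale_right mult.assoc flip: power_add mult_2)
  qed
  have "partial j (poisson f g) =
      (\<Sum>k\<in>Y. oscale (\<tau> (prime_ix k)) (partial j (partial (prime_ix k) f) \<star> partial k g)) +
      (\<Sum>k\<in>Y. oscale (\<tau> (prime_ix k)) (oscale (?s k) (partial (prime_ix k) f \<star> partial j (partial k g))))"
    unfolding poisson_eq[OF assms(3)] partial_sum sum.distrib[symmetric]
  proof (rule sum.cong)
    fix k assume k: "k \<in> Y"
    have f: "partial (prime_ix k) f \<in> homogeneous (\<mu> k)"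
      using partial_in_homogeneous[OF prime_ix_in_Y[OF k] assms(3)] k by (simp add: mu_prime_ix)
    show "partial j (oscale (\<tau> (prime_ix k)) (partial (prime_ix k) f \<star> partial k g)) =
        oscale (\<tau> (prime_ix k)) (partial j (partial (prime_ix k) f) \<star> partial k g) +
        oscale (\<tau> (prime_ix k)) (oscale (?s k) (partial (prime_ix k) f \<star> partial j (partial k g)))"
      unfolding partial_oscale partial_leibniz[OF assms(1,2,5) f partial_in_O[OF k O(2)]]
      by (simp add: oscale_add_right mult.commute)
  qed simp
  also have "(\<Sum>k\<in>Y. oscale (\<tau> (prime_ix k)) (partial j (partial (prime_ix k) f) \<star> partial k g)) =
      - (\<Sum>k\<in>Y. oscale (\<tau> k) (partial k g \<star> partial (prime_ix k) (partial j f)))"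
    unfolding sum_negf[symmetric] by (rule sum.cong) (simp_all only: twice_f)
  also have "(\<Sum>k\<in>Y. oscale (\<tau> k) (partial k g \<star> partial (prime_ix k) (partial j f))) =
      act (DH g) (partial j f)"
    unfolding act_def
    by (subst sum_prime_ix[symmetric])
      (auto intro!: sum.cong simp: lookup_DH[OF assms(4)] prime_ix_involution omult_oscale_left)
  also have "(\<Sum>k\<in>Y. oscale (\<tau> (prime_ix k))
        (oscale (?s k) (partial (prime_ix k) f \<star> partial j (partial k g)))) =
      act (DH f) (partial j g)"
    unfolding act_def
    by (rule sum.cong) (simp_all only: twice_g lookup_DH[OF assms(3)] omult_oscale_left if_True)
  finally show ?thesis by simp
qed

lemma act_oscale_right: "act X (oscale c f) = oscale c (act X f)"
  by (simp add: act_def partial_oscale omult_oscale_right oscale_sum)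

lemma poisson_in_homogeneous:
  "f \<in> homogeneous 0 \<Longrightarrow> g \<in> homogeneous 0 \<Longrightarrow> poisson f g \<in> homogeneous 0"
  by (simp add: poisson_def act_in_homogeneous DH_in_W_even)

lemma bracket_DH:
  fixes f g :: "'k::field sup"
  assumes "CHAR('k) = p" "prime p" "f \<in> homogeneous 0" "g \<in> homogeneous 0"
  shows "bracket (DH f) (DH g) = DH (poisson f g)"
proof (rule poly_mapping_eqI)
  fix k
  show "Poly_Mapping.lookup (bracket (DH f) (DH g)) k = Poly_Mapping.lookup (DH (poisson f g)) k"
    using partial_poisson[OF assms prime_ix_in_Y, of k]
    by (simp add: lookup_bracket DH_in_W_even assms(3,4) lookup_DH poisson_in_homogeneous
        act_oscale_right oscale_diff_right)
qed

text \<open>A derivative never reaches the top degree in the variable that it lowers.\<close>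

lemma lookup_partial_top:
  assumes "i \<in> Y" "f \<in> \<O>"
  shows "Poly_Mapping.lookup (partial i f) (\<pi>, \<omega>) = 0"
  using assms(2) unfolding \<O>_def mem_Collect_eq
proof (induction rule: keys_subset_induct)
  case (single s c)
  then obtain \<alpha> u where s: "s = (\<alpha>, u)" "\<alpha> \<in> \<A>" "u \<in> \<B>" by auto
  consider "i \<in> Y0" | "i \<in> Y1" using assms(1) by (auto simp: Y_def)
  then show ?case
  proof cases
    case 1
    have "Poly_Mapping.lookup \<pi> i = p ^ t i - 1"
      using 1 by (simp add: \<pi>_def lookup_sum lookup_single when_def)
    moreover have "Poly_Mapping.lookup \<alpha> i \<le> p ^ t i - 1"
      using 1 s by (simp add: \<A>_def)
    ultimately have "\<alpha> - Poly_Mapping.single i 1 \<noteq> \<pi>" if "Poly_Mapping.lookup \<alpha> i \<noteq> 0"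
      using that by (metis diff_less le_neq_implies_less less_numeral_extra(1) linorder_not_less
          lookup_minus lookup_single_eq not_gr_zero)
    then show ?thesis
      using 1 s by (auto simp: partial_monomial_even lookup_single when_def)
  next
    case 2
    then have "u - {i} \<noteq> \<omega>" by (auto simp: \<omega>_def)
    with 2 s show ?thesis by (auto simp: partial_monomial_odd lookup_single when_def)
  qed
qed (simp_all add: partial_add lookup_add)

text \<open>
  The Poisson bracket of \<open>f\<close> and \<open>g\<close> is a sum of derivatives \<open>\<partial>\<^sub>k (\<partial>\<^sub>k\<^sub>' f \<cdot> g)\<close>, up to the term
  in which \<open>\<Sum>\<^sub>k \<plusminus>\<partial>\<^sub>k \<partial>\<^sub>k\<^sub>' f\<close> multiplies \<open>g\<close>. This sum changes sign when \<open>k\<close> and \<open>k'\<close> are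
  exchanged, so it is zero in characteristic other than \<open>2\<close>.
\<close>

lemma lookup_poisson_top:
  fixes f g :: "'k::field sup"
  assumes "CHAR('k) = p" "prime p" "p \<noteq> 2" "f \<in> homogeneous 0" "g \<in> homogeneous 0"
  shows "Poly_Mapping.lookup (poisson f g) (\<pi>, \<omega>) = 0"
proof -
  have O: "f \<in> \<O>" "g \<in> \<O>" using assms homogeneous_subset_O by auto
  let ?c = "\<lambda>k. \<tau> (prime_ix k) * (-1) ^ \<mu> k :: 'k"
  let ?h = "\<lambda>k. oscale (?c k) (partial k (partial (prime_ix k) f))"
  have "?h (prime_ix k) = - ?h k" if k: "k \<in> Y" for k
  proof -
    have "partial (prime_ix k) (partial k f) =
        oscale ((-1) ^ (\<mu> k * \<mu> k)) (partial k (partial (prime_ix k) f))"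
      using partial_supercommute[OF prime_ix_in_Y[OF k] k O(1)] k by (simp add: mu_prime_ix)
    moreover have "(-1) ^ \<mu> k * (-1) ^ (\<mu> k * \<mu> k) = (1 :: 'k)"
      by (simp add: \<mu>_def)
    ultimately show ?thesis
      using k tau_prime_ix[OF k, where ?'k = 'k]
      by (simp add: prime_ix_involution mu_prime_ix mult.assoc)
  qed
  then have antisym: "(\<Sum>k\<in>Y. ?h k) = - (\<Sum>k\<in>Y. ?h k)"
    by (subst sum_prime_ix[symmetric]) (simp flip: sum_negf)
  have "(\<Sum>k\<in>Y. ?h k) = 0"
  proof (rule poly_mapping_eqI)
    fix s
    let ?x = "Poly_Mapping.lookup (\<Sum>k\<in>Y. ?h k) s"
    have "?x = - ?x"
      by (subst antisym) simp
    then have "of_nat 2 * ?x = 0" by (simp add: eq_neg_iff_add_eq_0)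
    moreover have "of_nat 2 \<noteq> (0 :: 'k)"
      using assms(1-3) primes_dvd_imp_eq[of p 2] by (auto simp: of_nat_eq_0_iff_char_dvd simp del: of_nat_numeral)
    ultimately show "?x = Poly_Mapping.lookup 0 s" by simp
  qed
  then have laplacian: "(\<Sum>k\<in>Y. ?h k \<star> g) = 0"
    by (simp flip: omult_sum_left)
  have deriv: "oscale (\<tau> (prime_ix k)) (partial (prime_ix k) f \<star> partial k g) =
      oscale (?c k) (partial k (partial (prime_ix k) f \<star> g)) - ?h k \<star> g" if k: "k \<in> Y" for k
  proof -
    have f: "partial (prime_ix k) f \<in> homogeneous (\<mu> k)"
      using partial_in_homogeneous[OF prime_ix_in_Y[OF k] assms(4)] k by (simp add: mu_prime_ix)
    have "(-1) ^ \<mu> k * (-1) ^ (\<mu> k * \<mu> k) = (1 :: 'k)"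
      by (simp add: \<mu>_def)
    then show ?thesis
      using partial_leibniz[OF assms(1,2) k f O(2)]
      by (simp add: oscale_add_right omult_oscale_left mult.assoc)
  qed
  have "poisson f g = (\<Sum>k\<in>Y. oscale (?c k) (partial k (partial (prime_ix k) f \<star> g)))"
    using laplacian by (simp add: poisson_eq[OF assms(4)] deriv sum_subtractf)
  moreover have "partial (prime_ix k) f \<star> g \<in> \<O>" if "k \<in> Y" for k
    using that O by (simp add: omult_in_O partial_in_O prime_ix_in_Y)
  ultimately show ?thesis
    by (simp add: lookup_sum lookup_partial_top)
qed

lemma H_bracket_closed:
  fixes X Z :: "'k::field wit"
  assumes "CHAR('k) = p" "prime p" "p \<noteq> 2" "X \<in> \<H>" "Z \<in> \<H>"
  shows "bracket X Z \<in> \<H>"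
proof -
  obtain f g where fg: "f \<in> hamiltonians" "g \<in> hamiltonians" "X = DH f" "Z = DH g"
    using assms(4,5) unfolding H_eq_image by blast
  then have hom: "f \<in> homogeneous 0" "g \<in> homogeneous 0"
    by (auto simp: hamiltonians_def)
  then have "poisson f g \<in> hamiltonians"
    by (simp add: hamiltonians_def poisson_in_homogeneous lookup_poisson_top[OF assms(1-3)])
  then show ?thesis
    unfolding H_eq_image fg(3,4) bracket_DH[OF assms(1,2) hom] by (rule imageI)
qed

lemma H_subset_W_even: "\<H> \<subseteq> \<W>"
  unfolding H_eq_image by (auto simp: hamiltonians_def DH_in_W_even)

text \<open>
  This is where evenness enters. If \<open>x\<^sub>k\<close> divides a monomial of \<open>f\<close>, then so does a second odd
  variable, because the number of odd variables in the monomial is even. The second one survives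
  in \<open>\<partial>\<^sub>k f\<close> and also occurs in \<open>\<partial>\<^sub>k x\<^sup>\<omega>\<close>.
\<close>

lemma act_H_top:
  assumes "X \<in> \<H>"
  shows "act X (xmon 0 \<omega>) = 0"
proof -
  obtain f where f: "f \<in> homogeneous 0" "X = DH f"
    using assms unfolding H_eq_image hamiltonians_def by blast
  have "partial (prime_ix k) f \<star> partial k (xmon 0 \<omega>) = 0" if k: "k \<in> Y" for k
  proof (cases "k \<in> Y0")
    case True
    then show ?thesis by (simp add: partial_xmon mono_deriv_def)
  next
    case False
    with k have k: "k \<in> Y1" by (simp add: Y_def)
    have \<omega>: "\<omega> \<in> \<B>" by (simp add: \<omega>_def \<B>_def)
    have "partial k f \<star> partial k (xmon 0 \<omega>) = 0"
      using f(1) unfolding homogeneous_keys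
    proof (induction rule: keys_subset_induct)
      case (single s c)
      then obtain \<alpha> u where s: "s = (\<alpha>, u)" "\<alpha> \<in> \<A>" "u \<in> \<B>" "even (card u)" by auto
      have "front_sign k u = (0 :: 'a) \<or> shuffle_sign (u - {k}) (\<omega> - {k}) = (0 :: 'a)"
      proof (cases "k \<in> u")
        case True
        have "card u \<noteq> Suc 0" using s by auto
        with True have "u - {k} \<noteq> {}"
          using s finite_B by (metis card.remove card.empty)
        then have "(u - {k}) \<inter> (\<omega> - {k}) \<noteq> {}"
          using s by (auto simp: \<B>_def \<omega>_def)
        then show ?thesis
          using s \<omega> finite_B by (simp add: shuffle_sign_eq_0)
      qed (simp add: front_sign_def)
      then show ?case
        using s k \<omega> keys_subset_Y0_of_A[OF s(2)]
        by (auto simp: xmon_def partial_monomial_odd omult_monomials B_Diff)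
    qed (simp_all add: partial_add omult_add_left)
    with k show ?thesis by (simp add: prime_ix_odd)
  qed
  then show ?thesis
    by (simp add: f(2) act_def lookup_DH[OF f(1)] omult_oscale_left)
qed

section \<open>The map \<open>\<Theta>\<close>\<close>

lemma lookup_Theta:
  assumes "i \<in> Y0" "X \<in> \<H>"
  shows "Poly_Mapping.lookup (\<Theta> i q X) k =
    xmon 0 \<omega> \<star> (partial i ^^ (p ^ q)) (Poly_Mapping.lookup X k)"
  using assms H_subset_W_even by (auto simp: \<Theta>_def lookup_omod ad_pd_funpow)

lemma Theta_in_W_even:
  assumes "i \<in> Y0" "even (card \<omega>)" "X \<in> \<H>"
  shows "\<Theta> i q X \<in> \<W>"
proof (rule W_evenI)
  fix k assume "k \<in> Y"
  then have "(partial i ^^ (p ^ q)) (Poly_Mapping.lookup X k) \<in> homogeneous (\<mu> k)"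
    using assms H_subset_W_even by (intro partial_funpow_closed W_even_coeff) auto
  moreover have "xmon 0 \<omega> \<in> homogeneous 0"
    using assms(2) by (auto simp: homogeneous_keys xmon_def \<A>_def \<B>_def \<omega>_def)
  ultimately show "Poly_Mapping.lookup (\<Theta> i q X) k \<in> homogeneous (\<mu> k)"
    using assms omult_in_homogeneous by (fastforce simp: lookup_Theta)
next
  fix k assume "k \<notin> Y"
  then show "Poly_Mapping.lookup (\<Theta> i q X) k = 0"
    using assms H_subset_W_even W_even_outside[of X k]
    by (auto simp: lookup_Theta partial_funpow_linear)
qed

lemma Theta_bracket:
  fixes X Z :: "'k::field wit"
  assumes "CHAR('k) = p" "prime p" "p \<noteq> 2" "i \<in> Y0" "even (card \<omega>)" "X \<in> \<H>" "Z \<in> \<H>"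
  shows "\<Theta> i q (bracket X Z) = bracket X (\<Theta> i q Z) - bracket Z (\<Theta> i q X)"
proof (rule poly_mapping_eqI)
  fix k
  let ?d = "partial i ^^ (p ^ q)" and ?w = "xmon 0 \<omega> :: 'k sup"
  let ?D = "\<lambda>X. (ad (pd i) ^^ (p ^ q)) X"
  have w: "?w \<in> homogeneous 0" "?w \<in> \<O>"
    using assms(5) by (auto simp: homogeneous_keys xmon_def \<A>_def \<B>_def \<omega>_def \<O>_def)
  have W: "X \<in> \<W>" "Z \<in> \<W>" using assms(6,7) H_subset_W_even by auto
  have bracket_Theta: "Poly_Mapping.lookup (bracket U (\<Theta> i q V)) k =
      ?w \<star> act U (?d (Poly_Mapping.lookup V k)) - ?w \<star> act (?D V) (Poly_Mapping.lookup U k)"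
    if U: "U \<in> \<H>" and V: "V \<in> \<H>" for U V
  proof -
    have UW: "U \<in> \<W>" "V \<in> \<W>" using U V H_subset_W_even by auto
    have "?d (Poly_Mapping.lookup V k) \<in> \<O>"
      using assms(4) UW by (simp add: partial_funpow_closed W_even_coeff_in_O)
    then have "act U (Poly_Mapping.lookup (\<Theta> i q V) k) = ?w \<star> act U (?d (Poly_Mapping.lookup V k))"
      using act_leibniz[OF assms(1,2) UW(1) w(1)] act_H_top[OF U] by (simp add: lookup_Theta[OF assms(4) V])
    moreover have "act (\<Theta> i q V) (Poly_Mapping.lookup U k) = ?w \<star> act (?D V) (Poly_Mapping.lookup U k)"
      using V act_omod[OF w(2) ad_pd_funpow(1)[OF assms(4) UW(2)] W_even_coeff_in_O[OF UW(1)]]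
      by (simp add: \<Theta>_def)
    ultimately show ?thesis
      by (simp add: lookup_bracket[OF UW(1) Theta_in_W_even[OF assms(4,5) V]])
  qed
  have "Poly_Mapping.lookup (\<Theta> i q (bracket X Z)) k =
      ?w \<star> ?d (act X (Poly_Mapping.lookup Z k) - act Z (Poly_Mapping.lookup X k))"
    by (simp add: lookup_Theta[OF assms(4) H_bracket_closed[OF assms(1-3,6,7)]] lookup_bracket[OF W])
  also have "\<dots> = ?w \<star>
      ((act (?D X) (Poly_Mapping.lookup Z k) + act X (?d (Poly_Mapping.lookup Z k))) -
       (act (?D Z) (Poly_Mapping.lookup X k) + act Z (?d (Poly_Mapping.lookup X k))))"
    unfolding partial_funpow_linear
    by (simp only: partial_prime_power_act[OF assms(1,2,4)] W W_even_coeff_in_O)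
  also have "\<dots> = Poly_Mapping.lookup (bracket X (\<Theta> i q Z)) k - Poly_Mapping.lookup (bracket Z (\<Theta> i q X)) k"
    unfolding bracket_Theta[OF assms(6,7)] bracket_Theta[OF assms(7,6)]
    by (simp add: omult_add_right omult_diff_right)
  finally show "Poly_Mapping.lookup (\<Theta> i q (bracket X Z)) k =
      Poly_Mapping.lookup (bracket X (\<Theta> i q Z) - bracket Z (\<Theta> i q X)) k"
    by (simp add: lookup_minus)
qed

lemma Theta_in_Der:
  assumes "CHAR('k::field) = p" "prime p" "p \<noteq> 2" "i \<in> Y0" "even (card \<omega>)"
  shows "\<Theta> i q \<in> Der (\<H> :: 'k wit set) \<W>"
proof -
  interpret vector_space "wscale :: 'k \<Rightarrow> 'k wit \<Rightarrow> 'k wit"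
    by (rule vector_space_wscale)
  have closed: "X + Z \<in> \<H>" if "X \<in> \<H>" "Z \<in> \<H>" for X Z :: "'k wit"
    using that unfolding \<H>_def by (rule span_add)
  have closed_scale: "wscale c X \<in> \<H>" if "X \<in> \<H>" for X :: "'k wit" and c
    using that unfolding \<H>_def by (rule span_scale)
  have "\<Theta> i q \<in> (\<H> :: 'k wit set) \<rightarrow>\<^sub>E \<W>"
    using Theta_in_W_even[OF assms(4,5)]
    by (intro PiE_I) (assumption | simp add: \<Theta>_def)+
  moreover have "\<Theta> i q (X + Z) = \<Theta> i q X + \<Theta> i q Z" if "X \<in> \<H>" "Z \<in> \<H>" for X Z :: "'k wit"
    by (rule poly_mapping_eqI)
      (simp add: lookup_Theta[OF assms(4)] that closed lookup_add partial_funpow_linear omult_add_right)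
  moreover have "\<Theta> i q (wscale c X) = wscale c (\<Theta> i q X)" if "X \<in> \<H>" for c and X :: "'k wit"
    by (rule poly_mapping_eqI)
      (simp add: lookup_Theta[OF assms(4)] that closed_scale partial_funpow_linear omult_oscale_right)
  ultimately show ?thesis
    using Theta_bracket[OF assms] by (simp add: Der_def)
qed

end

theorem proposition3p2:
  fixes p m n i q :: nat and t :: "nat \<Rightarrow> nat"
  assumes "CHAR('k::field) = p" and "p > 3"
    and "m > 1" and "n > 3"
    and "\<And>j. j \<in> witt_hamiltonian.Y0 m \<Longrightarrow> t j > 0"
    and "even (card (witt_hamiltonian.\<omega> m n))"
    and "i \<in> witt_hamiltonian.Y0 m" and "q > 0"
  shows "witt_hamiltonian.\<Theta> p m n t i q \<in>
    witt_hamiltonian.Der p m n t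
      (witt_hamiltonian.\<H> p m n t :: 'k wit set) (witt_hamiltonian.\<W> p m n t)"
proof -
  have "prime p"
    using prime_CHAR_semidom[where ?'a = 'k] assms(1,2) by simp
  then show ?thesis
    using assms by (intro witt_hamiltonian.Theta_in_Der) auto
qed

end
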